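(* The unilateral tree constraint satisfiability problem (UTC) is decidable: there is an algorithm which, given a finite label set $L$, a finite set $AC$ of arithmetic constraints and a finite set $TC$ of unilateral tree constraints over $L$, always terminates and correctly answers whether the system $(AC,TC)$ is satisfiable in $\mathbb{D}=\mathbb{Q}_{\ge 0}\cup\{\infty\}$.
   Context: Let $\mathbb{D}=\mathbb{Q}_{\ge 0}\cup\{\infty\}$, with the usual conventions $a+\infty=\infty+a=\infty$ and $\infty\ge a$ for all $a\in\mathbb{D}$. Let $L$ be a finite set of labels. A tree is an infinite tree in which every node has exactly one child for each label $l\in L$ and every node carries an element of $\mathbb{D}$. For a tree $T$, $\lozenge(T)\in\mathbb{D}$ is the value at its root, and $l(T)$ is the immediate subtree of $T$ with label $l$. For a word $w=l_1\cdots l_k\in L^*$ write $wT=l_1(l_2(\cdots l_k(T)\cdots))$. Equivalently, a tree is a function $T:L^*\to\mathbb{D}$ with $\lozenge(wT)=T(w)$. Syntax. Atomic trees: $t ::= x \mid l(t)$, where $x$ is a tree variable and $l\in L$; so an atomic tree has the form $wx$ with $w\in L^*$. A unilateral tree constraint is $t\ge t_1+\dots+t_n$ ($n\ge 1$), where $t,t_1,\dots,t_n$ are atomic trees (a single summand on the greater side). Atomic arithmetic expressions: $v ::= n\mid \lambda\mid \lozenge(t)$, where $n$ is a nonnegative integer constant, $\lambda$ is an arithmetic variable and $t$ is an atomic tree. Arithmetic terms: $h ::= v\mid h+h$. An arithmetic constraint is $h\ge h'$ for arithmetic terms $h,h'$ (arithmetic constraints may have several summands on both sides). Semantics. A valuation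 assigns a tree to each tree variable and an element of $\mathbb{D}$ to each arithmetic variable. It satisfies $t\ge t_1+\dots+t_n$ if the inequality holds pointwise, i.e. $\lozenge(ut)\ge\lozenge(ut_1)+\dots+\lozenge(ut_n)$ for every $u\in L^*$. It satisfies an arithmetic constraint if the inequality holds in $\mathbb{D}$. The system $(AC,TC)$ is satisfiable if some valuation satisfies all constraints in $AC\cup TC$ simultaneously. *)

theory Defs
  imports "HOL-Library.Extended_Nonnegative_Real" "HOL-Library.Nat_Bijection"
begin

section \<open>Syntax\<close>

datatype (labels_tree: 'l) atomic_tree = TVar nat | Child 'l "'l atomic_tree"

datatype (labels_atom: 'l) arith_atom = Const nat | AVar nat | Root "'l atomic_tree"

datatype (labels_term: 'l) arith_term = Atom "'l arith_atom" | Plus "'l arith_term" "'l arith_term"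

datatype (labels_ac: 'l) arith_constraint = ArithGe "'l arith_term" "'l arith_term"

text \<open>\<open>TreeGe t [t\<^sub>1, \<dots>, t\<^sub>n]\<close> stands for \<open>t \<ge> t\<^sub>1 + \<dots> + t\<^sub>n\<close>; the
  requirement \<open>n \<ge> 1\<close> is part of \<open>utc_instance\<close> below.\<close>

datatype (labels_tc: 'l) tree_constraint = TreeGe "'l atomic_tree" "'l atomic_tree list"

primrec summands :: "'l tree_constraint \<Rightarrow> 'l atomic_tree list" where
  "summands (TreeGe t ts) = ts"


section \<open>Semantics\<close>

definition DD :: "ennreal set" where
  "DD = insert \<infinity> {ennreal (real_of_rat q) | q. q \<ge> 0}"

text \<open>Since \<open>w T = l\<^sub>1 (l\<^sub>2 (\<dots> l\<^sub>k (T)))\<close> and \<open>T w\<close> is the root value of \<open>w T\<close>, a word is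
  read from right to left when descending from the root. Trees are total functions on
  words; only their values on \<open>lists L\<close> are constrained or inspected.\<close>

type_synonym 'l tree = "'l list \<Rightarrow> ennreal"

definition is_tree :: "'l set \<Rightarrow> 'l tree \<Rightarrow> bool" where
  "is_tree L T \<longleftrightarrow> (\<forall>w \<in> lists L. T w \<in> DD)"

definition root_val :: "'l tree \<Rightarrow> ennreal" where
  "root_val T = T []"

definition subtree :: "'l \<Rightarrow> 'l tree \<Rightarrow> 'l tree" where
  "subtree l T = (\<lambda>w. T (w @ [l]))"

definition subtree_at :: "'l list \<Rightarrow> 'l tree \<Rightarrow> 'l tree" where
  "subtree_at w T = foldr subtree w T"

lemma root_val_subtree_at: "root_val (subtree_at w T) = T w"
proof -
  have "foldr subtree w T u = T (u @ w)" for u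
    by (induction w arbitrary: u) (auto simp: subtree_def)
  then show ?thesis by (simp add: root_val_def subtree_at_def)
qed

primrec val_tree :: "(nat \<Rightarrow> 'l tree) \<Rightarrow> 'l atomic_tree \<Rightarrow> 'l tree" where
  "val_tree \<mu> (TVar x) = \<mu> x"
| "val_tree \<mu> (Child l t) = subtree l (val_tree \<mu> t)"

primrec val_atom :: "(nat \<Rightarrow> 'l tree) \<Rightarrow> (nat \<Rightarrow> ennreal) \<Rightarrow> 'l arith_atom \<Rightarrow> ennreal" where
  "val_atom \<mu> \<nu> (Const n) = of_nat n"
| "val_atom \<mu> \<nu> (AVar a) = \<nu> a"
| "val_atom \<mu> \<nu> (Root t) = root_val (val_tree \<mu> t)"

primrec val_term :: "(nat \<Rightarrow> 'l tree) \<Rightarrow> (nat \<Rightarrow> ennreal) \<Rightarrow> 'l arith_term \<Rightarrow> ennreal" where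
  "val_term \<mu> \<nu> (Atom v) = val_atom \<mu> \<nu> v"
| "val_term \<mu> \<nu> (Plus h h') = val_term \<mu> \<nu> h + val_term \<mu> \<nu> h'"

primrec sat_ac :: "(nat \<Rightarrow> 'l tree) \<Rightarrow> (nat \<Rightarrow> ennreal) \<Rightarrow> 'l arith_constraint \<Rightarrow> bool" where
  "sat_ac \<mu> \<nu> (ArithGe h h') \<longleftrightarrow> val_term \<mu> \<nu> h \<ge> val_term \<mu> \<nu> h'"

primrec sat_tc :: "'l set \<Rightarrow> (nat \<Rightarrow> 'l tree) \<Rightarrow> 'l tree_constraint \<Rightarrow> bool" where
  "sat_tc L \<mu> (TreeGe t ts) \<longleftrightarrow>
     (\<forall>u \<in> lists L. root_val (subtree_at u (val_tree \<mu> t))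
        \<ge> (\<Sum>s \<leftarrow> ts. root_val (subtree_at u (val_tree \<mu> s))))"

definition satisfiable ::
    "'l set \<Rightarrow> 'l arith_constraint set \<Rightarrow> 'l tree_constraint set \<Rightarrow> bool" where
  "satisfiable L AC TC \<longleftrightarrow>
     (\<exists>\<mu> \<nu>. (\<forall>x. is_tree L (\<mu> x)) \<and> (\<forall>a. \<nu> a \<in> DD)
        \<and> (\<forall>c \<in> AC. sat_ac \<mu> \<nu> c) \<and> (\<forall>c \<in> TC. sat_tc L \<mu> c))"

definition utc_instance ::
    "'l set \<Rightarrow> 'l arith_constraint set \<Rightarrow> 'l tree_constraint set \<Rightarrow> bool" where
  "utc_instance L AC TC \<longleftrightarrow>
     finite L \<and> finite AC \<and> finite TC
     \<and> (\<forall>c \<in> AC. labels_ac c \<subseteq> L)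
     \<and> (\<forall>c \<in> TC. labels_tc c \<subseteq> L \<and> summands c \<noteq> [])"


section \<open>Algorithms: partial recursive functions\<close>

datatype recf = Zero | Succ | Proj nat | Comp recf "recf list" | PrimRec recf recf | Mu recf

text \<open>\<open>computes p xs y\<close>: the program \<open>p\<close> halts on the argument list \<open>xs\<close> with result \<open>y\<close>.
  No result is assigned when the arity is wrong or a minimisation does not terminate.\<close>

inductive computes :: "recf \<Rightarrow> nat list \<Rightarrow> nat \<Rightarrow> bool" where
  zero: "computes Zero xs 0"
| succ: "computes Succ [x] (Suc x)"
| proj: "i < length xs \<Longrightarrow> computes (Proj i) xs (xs ! i)"
| comp: "list_all2 (\<lambda>f y. computes f xs y) fs ys \<Longrightarrow> computes g ys z
    \<Longrightarrow> computes (Comp g fs) xs z"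
| primrec_0: "computes f xs z \<Longrightarrow> computes (PrimRec f g) (0 # xs) z"
| primrec_Suc: "computes (PrimRec f g) (k # xs) r \<Longrightarrow> computes g (k # r # xs) z
    \<Longrightarrow> computes (PrimRec f g) (Suc k # xs) z"
| mu: "computes f (y # xs) 0 \<Longrightarrow> (\<And>i. i < y \<Longrightarrow> \<exists>v. computes f (i # xs) (Suc v))
    \<Longrightarrow> computes (Mu f) xs y"

lemma computes_deterministic:
  "computes p xs y \<Longrightarrow> computes p xs z \<Longrightarrow> y = z"
proof (induction arbitrary: z rule: computes.induct)
  case (zero xs)
  then show ?case by cases auto
next
  case (succ x)
  then show ?case by cases auto
next
  case (proj i xs)
  from proj.prems show ?case by cases auto
next
  case (comp xs fs ys g z')
  from comp.prems obtain ys' where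
    ys': "list_all2 (\<lambda>f y. computes f xs y) fs ys'" "computes g ys' z"
    by cases
  have "ys = ys'"
    using comp.IH(1) ys'(1)
    by (auto simp: list_all2_conv_all_nth intro!: nth_equalityI)
  then show ?case using comp.IH ys'(2) by blast
next
  case (primrec_0 f xs z' g)
  from primrec_0.prems show ?case by cases (use primrec_0.IH in auto)
next
  case (primrec_Suc f g k xs r z')
  from primrec_Suc.prems obtain r' where
    "computes (PrimRec f g) (k # xs) r'" "computes g (k # r' # xs) z"
    by cases auto
  then show ?case using primrec_Suc.IH by blast
next
  case (mu f y xs)
  from mu.prems obtain z0: "computes f (z # xs) 0"
    and z1: "\<And>i. i < z \<Longrightarrow> \<exists>v. computes f (i # xs) (Suc v)"
    by cases blast
  have "\<not> y < z" using z1[of y] mu.IH(1) by (metis nat.distinct(1))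
  moreover have "\<not> z < y" using mu.IH(2)[of z] z0 by (metis nat.distinct(1))
  ultimately show ?case by simp
qed


section \<open>Effective encoding of instances\<close>

text \<open>The encodings are built from the explicit (computable) bijections \<open>prod_encode\<close>,
  \<open>sum_encode\<close> and \<open>list_encode\<close>. Labels are natural numbers, and the finite sets of an
  instance are presented by listing their elements.\<close>

primrec enc_tree :: "nat atomic_tree \<Rightarrow> nat" where
  "enc_tree (TVar x) = sum_encode (Inl x)"
| "enc_tree (Child l t) = sum_encode (Inr (prod_encode (l, enc_tree t)))"

primrec enc_atom :: "nat arith_atom \<Rightarrow> nat" where
  "enc_atom (Const n) = sum_encode (Inl n)"
| "enc_atom (AVar a) = sum_encode (Inr (sum_encode (Inl a)))"
| "enc_atom (Root t) = sum_encode (Inr (sum_encode (Inr (enc_tree t))))"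

primrec enc_term :: "nat arith_term \<Rightarrow> nat" where
  "enc_term (Atom v) = sum_encode (Inl (enc_atom v))"
| "enc_term (Plus h h') = sum_encode (Inr (prod_encode (enc_term h, enc_term h')))"

primrec enc_ac :: "nat arith_constraint \<Rightarrow> nat" where
  "enc_ac (ArithGe h h') = prod_encode (enc_term h, enc_term h')"

primrec enc_tc :: "nat tree_constraint \<Rightarrow> nat" where
  "enc_tc (TreeGe t ts) = prod_encode (enc_tree t, list_encode (map enc_tree ts))"

definition enc_instance ::
    "nat list \<Rightarrow> nat arith_constraint list \<Rightarrow> nat tree_constraint list \<Rightarrow> nat" where
  "enc_instance L AC TC =
     prod_encode (list_encode L,
       prod_encode (list_encode (map enc_ac AC), list_encode (map enc_tc TC)))"

lemma enc_tree_inj: "enc_tree s = enc_tree t \<Longrightarrow> s = t"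
proof (induction s arbitrary: t)
  case (TVar x) then show ?case by (cases t) (auto dest: injD[OF inj_sum_encode])
next
  case (Child l s) then show ?case by (cases t) (auto dest: injD[OF inj_sum_encode])
qed

lemma enc_atom_inj: "enc_atom v = enc_atom v' \<Longrightarrow> v = v'"
  by (cases v; cases v') (auto dest!: injD[OF inj_sum_encode] enc_tree_inj)

lemma enc_term_inj: "enc_term h = enc_term h' \<Longrightarrow> h = h'"
proof (induction h arbitrary: h')
  case (Atom v) then show ?case
    by (cases h') (auto dest!: injD[OF inj_sum_encode] enc_atom_inj)
next
  case (Plus h1 h2) then show ?case
    by (cases h') (auto dest!: injD[OF inj_sum_encode])
qed

lemma enc_ac_inj: "inj enc_ac"
proof (rule injI)
  fix c d assume "enc_ac c = enc_ac d"
  then show "c = d" by (cases c; cases d) (auto dest!: enc_term_inj)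
qed

lemma enc_tc_inj: "inj enc_tc"
proof (rule injI)
  fix c d assume "enc_tc c = enc_tc d"
  moreover have "inj enc_tree" by (rule injI) (rule enc_tree_inj)
  ultimately show "c = d"
    by (cases c; cases d) (auto dest!: enc_tree_inj simp: list_encode_eq inj_map_eq_map)
qed

lemma enc_instance_inj:
  "enc_instance L AC TC = enc_instance L' AC' TC' \<Longrightarrow> L = L' \<and> AC = AC' \<and> TC = TC'"
  by (auto simp: enc_instance_def list_encode_eq inj_map_eq_map[OF enc_ac_inj] inj_map_eq_map[OF enc_tc_inj])

end

theory Submission
  imports Defs "HOL-Analysis.Kronecker_Approximation_Theorem" "HOL-Library.Diagonal_Subsequence"
begin

text \<open>
  Satisfiability and unsatisfiability are both witnessed by finite certificates, and the
  algorithm searches for either one.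

  If a system has no solution, even over the compact space of trees with values in the
  extended nonnegative reals, then by compactness there is an \<open>n\<close> for which finitely many
  constraints have no approximate solution on the grid of mesh \<open>1/n\<close> truncated at \<open>n\<close>,
  which is a finite check.

  If it has a real solution \<open>X\<close>, replace \<open>X\<close> by \<open>\<lfloor>\<lambda> X\<rfloor>\<close>, truncated to infinity above a large
  bound. Since \<open>x \<mapsto> \<lfloor>\<lambda> x\<rfloor>\<close> is superadditive, constraints with a single summand on the greater
  side survive for every \<open>\<lambda> > 0\<close>. Dirichlet's simultaneous approximation theorem yields a
  \<open>\<lambda>\<close> that puts the finitely many values in the arithmetic constraints just above integers,
  so that these constraints survive as well. The result has finitely many values. Reading words
  from the far end, all its constraints are local, so that it is described by a finite
  set of windows closed under successors, from which a rational solution can be unfolded.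
\<close>

section \<open>Computable functions\<close>

definition computable :: "(nat \<Rightarrow> nat) \<Rightarrow> bool" where
  "computable f \<longleftrightarrow> (\<exists>p. \<forall>x. computes p [x] (f x))"

text \<open>Binary functions serve to bootstrap pairing. Once pairing and its projections are
  computable, several arguments are passed as one nested pair.\<close>

definition computable2 :: "(nat \<Rightarrow> nat \<Rightarrow> nat) \<Rightarrow> bool" where
  "computable2 f \<longleftrightarrow> (\<exists>p. \<forall>x y. computes p [x, y] (f x y))"

definition decidable :: "(nat \<Rightarrow> bool) \<Rightarrow> bool" where
  "decidable P \<longleftrightarrow> computable (\<lambda>x. of_bool (P x))"

lemma computes_Comp1:
  "computes f xs y \<Longrightarrow> computes g [y] z \<Longrightarrow> computes (Comp g [f]) xs z"
  by (rule computes.comp[where ys = "[y]"]) auto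

lemma computes_Comp2:
  "computes f xs y \<Longrightarrow> computes f' xs y' \<Longrightarrow> computes g [y, y'] z
    \<Longrightarrow> computes (Comp g [f, f']) xs z"
  by (rule computes.comp[where ys = "[y, y']"]) auto

lemma computes_Proj: "i < length xs \<Longrightarrow> y = xs ! i \<Longrightarrow> computes (Proj i) xs y"
  by (simp add: computes.proj)

lemma computable_id: "computable (\<lambda>x. x)"
  unfolding computable_def by (rule exI[of _ "Proj 0"]) (auto intro!: computes_Proj)

lemma computable_comp:
  assumes "computable g" "computable f"
  shows "computable (\<lambda>x. g (f x))"
proof -
  obtain p q where "\<And>x. computes p [x] (f x)" "\<And>x. computes q [x] (g x)"
    using assms unfolding computable_def by blast
  then have "computes (Comp q [p]) [x] (g (f x))" for x by (rule computes_Comp1)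
  then show ?thesis unfolding computable_def by blast
qed

lemma computable_comp2:
  assumes "computable2 h" "computable f" "computable g"
  shows "computable (\<lambda>x. h (f x) (g x))"
proof -
  obtain p q r where "\<And>x. computes p [x] (f x)" "\<And>x. computes q [x] (g x)"
    "\<And>x y. computes r [x, y] (h x y)"
    using assms unfolding computable_def computable2_def by blast
  then have "computes (Comp r [p, q]) [x] (h (f x) (g x))" for x by (rule computes_Comp2)
  then show ?thesis unfolding computable_def by blast
qed

lemma computable2_comp:
  assumes "computable g" "computable2 f"
  shows "computable2 (\<lambda>x y. g (f x y))"
proof -
  obtain p q where "\<And>x y. computes p [x, y] (f x y)" "\<And>x. computes q [x] (g x)"
    using assms unfolding computable_def computable2_def by blast
  then have "computes (Comp q [p]) [x, y] (g (f x y))" for x y by (rule computes_Comp1)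
  then show ?thesis unfolding computable2_def by blast
qed

lemma computable2_comp2:
  assumes "computable2 h" "computable2 f" "computable2 g"
  shows "computable2 (\<lambda>x y. h (f x y) (g x y))"
proof -
  obtain p q r where "\<And>x y. computes p [x, y] (f x y)" "\<And>x y. computes q [x, y] (g x y)"
    "\<And>x y. computes r [x, y] (h x y)"
    using assms unfolding computable2_def by blast
  then have "computes (Comp r [p, q]) [x, y] (h (f x y) (g x y))" for x y by (rule computes_Comp2)
  then show ?thesis unfolding computable2_def by blast
qed

lemma computable2_fst: "computable2 (\<lambda>x y. x)"
  unfolding computable2_def by (rule exI[of _ "Proj 0"]) (auto intro!: computes_Proj)

lemma computable2_snd: "computable2 (\<lambda>x y. y)"
  unfolding computable2_def by (rule exI[of _ "Proj 1"]) (auto intro!: computes_Proj)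

lemma computable_Suc': "computable Suc"
  unfolding computable_def by (auto intro: computes.succ)

lemma computable_const: "computable (\<lambda>x. n)"
proof (induction n)
  case 0
  show ?case unfolding computable_def by (auto intro: computes.zero)
next
  case (Suc n)
  then show ?case by (rule computable_comp[OF computable_Suc'])
qed

lemma computes_PrimRec:
  assumes "computes f xs z" "\<And>k r. computes g (k # r # xs) (h k r)"
  shows "computes (PrimRec f g) (n # xs) (rec_nat z h n)"
proof (induction n)
  case 0
  show ?case using assms(1) by (auto intro: computes.primrec_0)
next
  case (Suc n)
  then show ?case using assms(2) by (auto intro: computes.primrec_Suc)
qed

lemma computable_rec_const:
  assumes "computable2 h"
  shows "computable (\<lambda>n. rec_nat a h n)"
proof -
  obtain p where p: "\<And>k r. computes p [k, r] (h k r)"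
    using assms unfolding computable2_def by blast
  obtain c where c: "\<And>x. computes c [x] a"
    using computable_const[of a] unfolding computable_def by blast
  \<comment> \<open>\<open>PrimRec\<close> passes a parameter list to its base program, and
    \<open>c\<close> expects one argument; \<open>n\<close> itself is repeated as a dummy
    parameter.\<close>
  have "computes (PrimRec c (Comp p [Proj 0, Proj 1])) [n, n] (rec_nat a h n)" for n
    by (rule computes_PrimRec[OF c]) (auto intro!: computes_Comp2 p computes_Proj)
  then have "computes (Comp (PrimRec c (Comp p [Proj 0, Proj 1])) [Proj 0, Proj 0]) [n] (rec_nat a h n)" for n
    by (auto intro!: computes_Comp2 computes_Proj)
  then show ?thesis unfolding computable_def by blast
qed

lemma computable2_rec:
  assumes "computable f" "computable h"
  shows "computable2 (\<lambda>n x. rec_nat (f x) (\<lambda>_. h) n)"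
proof -
  obtain p q where p: "\<And>x. computes p [x] (f x)" and q: "\<And>x. computes q [x] (h x)"
    using assms unfolding computable_def by blast
  have "computes (PrimRec p (Comp q [Proj 1])) [n, x] (rec_nat (f x) (\<lambda>_. h) n)" for n x
    by (rule computes_PrimRec[OF p]) (auto intro!: computes_Comp1 q computes_Proj)
  then show ?thesis unfolding computable2_def by blast
qed

lemma computable2_add: "computable2 (+)"
proof -
  have "rec_nat y (\<lambda>_. Suc) x = x + y" for x y :: nat by (induction x) auto
  then show ?thesis using computable2_rec[OF computable_id computable_Suc'] by simp
qed

lemma computable_pred: "computable (\<lambda>x. x - 1)"
proof -
  have "rec_nat 0 (\<lambda>k r. k) x = x - 1" for x by (cases x) auto
  then show ?thesis using computable_rec_const[OF computable2_fst, of 0] by simp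
qed

lemma computable2_diff: "computable2 (-)"
proof -
  have "rec_nat x (\<lambda>_ r. r - 1) y = x - y" for x y :: nat by (induction y) auto
  then have "computable2 (\<lambda>y x. x - y)"
    using computable2_rec[OF computable_id computable_pred] by simp
  from computable2_comp2[OF this computable2_snd computable2_fst] show ?thesis .
qed

lemma computable_triangle: "computable triangle"
proof -
  have "rec_nat 0 (\<lambda>k r. r + Suc k) n = triangle n" for n by (induction n) auto
  moreover have "computable2 (\<lambda>k r. r + Suc k)"
    by (intro computable2_comp2[OF computable2_add] computable2_snd
        computable2_comp[OF computable_Suc'] computable2_fst)
  ultimately show ?thesis using computable_rec_const[of "\<lambda>k r. r + Suc k" 0] by simp
qed

subsection \<open>Pairing\<close>

definition pair :: "nat \<Rightarrow> nat \<Rightarrow> nat" where "pair x y = prod_encode (x, y)"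
definition pfst :: "nat \<Rightarrow> nat" where "pfst z = fst (prod_decode z)"
definition psnd :: "nat \<Rightarrow> nat" where "psnd z = snd (prod_decode z)"

lemma pfst_pair [simp]: "pfst (pair x y) = x"
  and psnd_pair [simp]: "psnd (pair x y) = y"
  by (simp_all add: pfst_def psnd_def pair_def)

lemma pair_pfst_psnd [simp]: "pair (pfst z) (psnd z) = z"
  by (simp add: pfst_def psnd_def pair_def)

lemma pfst_le: "pfst z \<le> z" and psnd_le: "psnd z \<le> z"
  using le_prod_encode_1[of "pfst z" "psnd z"] le_prod_encode_2[of "psnd z" "pfst z"]
  by (simp_all flip: pair_def)

lemma computable2_pair: "computable2 pair"
  unfolding pair_def prod_encode_def prod.case
  by (intro computable2_comp2[OF computable2_add] computable2_comp[OF computable_triangle]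
      computable2_fst computable2_snd)

text \<open>The index of the diagonal on which \<open>z\<close> lies in the Cantor enumeration of
  pairs. Both projections are recovered from it by subtraction.\<close>

definition pdiag :: "nat \<Rightarrow> nat" where "pdiag z = pfst z + psnd z"

lemma pair_diag: "z = triangle (pdiag z) + pfst z"
  unfolding pdiag_def using pair_pfst_psnd[of z]
  by (simp add: pair_def prod_encode_def del: pair_pfst_psnd)

lemma mono_triangle: "m \<le> n \<Longrightarrow> triangle m \<le> triangle n"
  by (induction rule: dec_induct) auto

section \<open>Minimisation and the inverse of the pairing function\<close>

lemma computes_Mu_Least:
  assumes "\<And>y. computes p (y # xs) (f y)" "\<exists>y. f y = 0"
  shows "computes (Mu p) xs (LEAST y. f y = 0)"
proof (rule computes.mu)
  show "computes p ((LEAST y. f y = 0) # xs) 0"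
    using assms(1)[of "LEAST y. f y = 0"] LeastI_ex[OF assms(2)] by simp
  fix i assume "i < (LEAST y. f y = 0)"
  then have "f i \<noteq> 0" by (rule not_less_Least)
  then show "\<exists>v. computes p (i # xs) (Suc v)"
    using assms(1)[of i] by (cases "f i") auto
qed

lemma computable_Least:
  assumes "computable2 (\<lambda>y x. f x y)" "\<And>x. \<exists>y. f x y = 0"
  shows "computable (\<lambda>x. LEAST y. f x y = 0)"
proof -
  obtain p where "\<And>y x. computes p [y, x] (f x y)"
    using assms(1) unfolding computable2_def by blast
  then have "computes (Mu p) [x] (LEAST y. f x y = 0)" for x
    by (intro computes_Mu_Least assms(2))
  then show ?thesis unfolding computable_def by blast
qed

text \<open>Diagonals begin at triangular numbers, so the index is the least \<open>y\<close> with
  \<open>z < triangle (Suc y)\<close>. Truncated subtraction turns this test into an equation with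
  0, as minimisation requires.\<close>

lemma computable_pdiag: "computable pdiag"
proof -
  have eq: "(LEAST y. Suc z - triangle (Suc y) = 0) = pdiag z" for z
  proof (rule Least_equality)
    show "Suc z - triangle (Suc (pdiag z)) = 0"
      using pair_diag[of z] by (simp add: pdiag_def)
    fix y assume "Suc z - triangle (Suc y) = 0"
    then have *: "Suc (triangle (pdiag z)) \<le> triangle (Suc y)"
      using pair_diag[of z] by linarith
    show "pdiag z \<le> y"
    proof (rule ccontr)
      assume "\<not> pdiag z \<le> y"
      then have "triangle (Suc y) \<le> triangle (pdiag z)" by (intro mono_triangle) simp
      with * show False by simp
    qed
  qed
  have "computable2 (\<lambda>y z. Suc z - triangle (Suc y))"
    by (intro computable2_comp2[OF computable2_diff] computable2_comp[OF computable_triangle]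
        computable2_comp[OF computable_Suc'] computable2_fst computable2_snd)
  moreover have "\<exists>y. Suc z - triangle (Suc y) = 0" for z
    by (rule exI[of _ z]) (simp add: triangle_def)
  ultimately have "computable (\<lambda>z. LEAST y. Suc z - triangle (Suc y) = 0)"
    by (rule computable_Least)
  then show ?thesis unfolding eq .
qed

lemma computable_pfst': "computable pfst"
proof -
  have "computable (\<lambda>z. z - triangle (pdiag z))"
    by (intro computable_comp2[OF computable2_diff] computable_id
        computable_comp[OF computable_triangle] computable_pdiag)
  moreover have "z - triangle (pdiag z) = pfst z" for z
    using pair_diag[of z] by linarith
  ultimately show ?thesis by simp
qed

lemma computable_psnd': "computable psnd"
proof -
  have "computable (\<lambda>z. pdiag z - pfst z)"
    by (intro computable_comp2[OF computable2_diff] computable_pdiag computable_pfst')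
  moreover have "(\<lambda>z. pdiag z - pfst z) = psnd"
    by (simp add: pdiag_def)
  ultimately show ?thesis by simp
qed

lemmas computable_pair = computable_comp2[OF computable2_pair]
lemmas computable_pfst = computable_comp[OF computable_pfst']
lemmas computable_psnd = computable_comp[OF computable_psnd']
lemmas computable_Suc = computable_comp[OF computable_Suc']
lemmas computable_add = computable_comp2[OF computable2_add]
lemmas computable_diff = computable_comp2[OF computable2_diff]

named_theorems comp_intros

declare computable_id [comp_intros] computable_const [comp_intros] computable_pair [comp_intros]
  computable_pfst [comp_intros] computable_psnd [comp_intros] computable_Suc [comp_intros]
  computable_add [comp_intros] computable_diff [comp_intros]

subsection \<open>Recursion and arithmetic\<close>

text \<open>In the rules below, a function of several arguments is presented as a function of
  the nested pair of its arguments.\<close>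

lemma computable_rec_nat [comp_intros]:
  assumes "computable n" "computable a"
    "computable (\<lambda>z. h (pfst z) (pfst (psnd z)) (psnd (psnd z)))"
  shows "computable (\<lambda>x. rec_nat (a x) (\<lambda>k r. h x k r) (n x))"
proof -
  obtain pn pa ph where pn: "\<And>x. computes pn [x] (n x)" and pa: "\<And>x. computes pa [x] (a x)"
    and ph: "\<And>z. computes ph [z] (h (pfst z) (pfst (psnd z)) (psnd (psnd z)))"
    using assms unfolding computable_def by blast
  obtain pp where pp: "\<And>x y. computes pp [x, y] (pair x y)"
    using computable2_pair unfolding computable2_def by blast
  \<comment> \<open>The recursion supplies \<open>k\<close>, \<open>r\<close>, \<open>x\<close> in
    this order, whereas the program for \<open>h\<close> expects one code with \<open>x\<close> in
    front.\<close>
  define g where "g = Comp ph [Comp pp [Proj 2, Comp pp [Proj 0, Proj 1]]]"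
  have g: "computes g [k, r, x] (h x k r)" for k r x
  proof -
    have "computes (Comp pp [Proj 2, Comp pp [Proj 0, Proj 1]]) [k, r, x] (pair x (pair k r))"
      by (rule computes_Comp2[OF computes_Proj computes_Comp2[OF computes_Proj computes_Proj pp] pp]) auto
    then show ?thesis using ph[of "pair x (pair k r)"] unfolding g_def
      by (auto intro: computes_Comp1)
  qed
  have "computes (Comp (PrimRec pa g) [pn, Proj 0]) [x] (rec_nat (a x) (h x) (n x))" for x
    by (rule computes_Comp2[OF pn computes_Proj computes_PrimRec]) (auto intro: pa g)
  then show ?thesis unfolding computable_def by blast
qed

lemma computable_mult [comp_intros]:
  assumes "computable f" "computable g"
  shows "computable (\<lambda>x. f x * g x)"
proof -
  have "rec_nat 0 (\<lambda>k r. r + m) n = n * m" for m n :: nat by (induction n) auto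
  moreover have "computable (\<lambda>x. rec_nat 0 (\<lambda>k r. r + g x) (f x))"
    by (intro comp_intros assms computable_comp[OF assms(2)])
  ultimately show ?thesis by simp
qed

lemma computable_power [comp_intros]:
  assumes "computable f" "computable g"
  shows "computable (\<lambda>x. f x ^ g x)"
proof -
  have "rec_nat 1 (\<lambda>k r. r * m) n = m ^ n" for m n :: nat by (induction n) auto
  moreover have "computable (\<lambda>x. rec_nat 1 (\<lambda>k r. r * f x) (g x))"
    by (intro comp_intros assms computable_comp[OF assms(1)])
  ultimately show ?thesis by simp
qed

section \<open>Decidable predicates and definition by cases\<close>

lemma decidable_eq_0: 
  assumes "computable f" 
  shows "decidable (\<lambda>x. f x = 0)"
proof -
  have "of_bool (n = 0) = 1 - n" for n :: nat by simp
  then show ?thesis unfolding decidable_def by (simp only:) (intro comp_intros assms)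
qed

lemma decidable_not [comp_intros]:
  assumes "decidable P"
  shows "decidable (\<lambda>x. \<not> P x)"
proof -
  have "of_bool (\<not> b) = 1 - (of_bool b :: nat)" for b by simp
  then show ?thesis
    using assms unfolding decidable_def by (simp only:) (intro comp_intros)
qed

lemma decidable_conj [comp_intros]:
  assumes "decidable P" "decidable Q"
  shows "decidable (\<lambda>x. P x \<and> Q x)"
  using assms unfolding decidable_def of_bool_conj by (intro comp_intros)

lemma decidable_disj [comp_intros]:
  assumes "decidable P" "decidable Q"
  shows "decidable (\<lambda>x. P x \<or> Q x)"
  using decidable_not[OF decidable_conj[OF assms[THEN decidable_not]]] by simp

lemma decidable_imp [comp_intros]:
  assumes "decidable P" "decidable Q"
  shows "decidable (\<lambda>x. P x \<longrightarrow> Q x)"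
  using decidable_disj[OF decidable_not[OF assms(1)] assms(2)] by (simp only: imp_conv_disj)

lemma decidable_le [comp_intros]:
  assumes "computable f" "computable g"
  shows "decidable (\<lambda>x. f x \<le> g x)"
  using decidable_eq_0[OF computable_diff[OF assms]] by simp

lemma decidable_less [comp_intros]:
  assumes "computable f" "computable g"
  shows "decidable (\<lambda>x. f x < g x)"
  using decidable_not[OF decidable_le[OF assms(2,1)]] by (simp add: not_le)

lemma decidable_eq [comp_intros]:
  assumes "computable f" "computable g"
  shows "decidable (\<lambda>x. f x = g x)"
  using decidable_conj[OF decidable_le[OF assms] decidable_le[OF assms(2,1)]]
  by (simp flip: order_eq_iff)

text \<open>Both branches are total, so both can be evaluated and the choice made
  arithmetically.\<close>

lemma computable_if [comp_intros]:
  assumes "decidable P" "computable f" "computable g"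
  shows "computable (\<lambda>x. if P x then f x else g x)"
proof -
  have "(if b then m else n) = of_bool b * m + of_bool (\<not> b) * n" for b and m n :: nat by simp
  then show ?thesis
    using assms(1) decidable_not[OF assms(1)] unfolding decidable_def
    by (simp only:) (intro comp_intros assms)
qed

lemma computable_min [comp_intros]:
  assumes "computable f" "computable g"
  shows "computable (\<lambda>x. min (f x) (g x))"
  unfolding min_def by (intro comp_intros assms)

lemma decidable_all_less [comp_intros]:
  assumes "computable n" "decidable (\<lambda>z. P (pfst z) (psnd z))"
  shows "decidable (\<lambda>x. \<forall>y<n x. P x y)"
proof -
  have "rec_nat 1 (\<lambda>k r. r * of_bool (Q k)) m = (of_bool (\<forall>y<m. Q y) :: nat)" for Q m
    by (induction m) (auto simp: less_Suc_eq)
  moreover have "computable (\<lambda>z. of_bool (P (pfst z) (pfst (psnd z))))"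
    using computable_comp[OF assms(2)[unfolded decidable_def],
        of "\<lambda>z. pair (pfst z) (pfst (psnd z))"] by (simp add: comp_intros)
  then have "computable (\<lambda>x. rec_nat 1 (\<lambda>k r. r * of_bool (P x k)) (n x))"
    by (intro comp_intros assms)
  ultimately show ?thesis unfolding decidable_def by simp
qed

lemma decidable_ex_less [comp_intros]:
  assumes "computable n" "decidable (\<lambda>z. P (pfst z) (psnd z))"
  shows "decidable (\<lambda>x. \<exists>y<n x. P x y)"
  using decidable_not[OF decidable_all_less[OF assms(1) decidable_not[OF assms(2)]]] by simp

text \<open>Halting is promised only for inputs that have a witness. This partial form suits the
  final algorithm, because a number that codes no instance need not have a certificate.\<close>

lemma computes_search:
  assumes "decidable (\<lambda>z. P (pfst z) (psnd z))" "computable (\<lambda>z. g (pfst z) (psnd z))"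
  shows "\<exists>p. \<forall>x. (\<exists>y. P x y) \<longrightarrow> computes p [x] (g x (LEAST y. P x y))"
proof -
  define f where "f x y = (of_bool (\<not> P x y) :: nat)" for x y
  have f: "f x y = 0 \<longleftrightarrow> P x y" for x y by (simp add: f_def)
  obtain pf where pf: "\<And>z. computes pf [z] (f (pfst z) (psnd z))"
    using decidable_not[OF assms(1)] unfolding decidable_def computable_def f_def by blast
  obtain pg where pg: "\<And>z. computes pg [z] (g (pfst z) (psnd z))"
    using assms(2) unfolding computable_def by blast
  obtain pp where pp: "\<And>x y. computes pp [x, y] (pair x y)"
    using computable2_pair unfolding computable2_def by blast
  have test: "computes (Comp pf [Comp pp [Proj 1, Proj 0]]) [y, x] (f x y)" for x y
  proof (rule computes_Comp1)
    show "computes (Comp pp [Proj 1, Proj 0]) [y, x] (pair x y)"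
      by (rule computes_Comp2[OF computes_Proj computes_Proj pp]) auto
    show "computes pf [pair x y] (f x y)" using pf[of "pair x y"] by simp
  qed
  have "computes (Comp pg [Comp pp [Proj 0, Mu (Comp pf [Comp pp [Proj 1, Proj 0]])]]) [x]
      (g x (LEAST y. P x y))" if "\<exists>y. P x y" for x
  proof (rule computes_Comp1)
    have mu: "computes (Mu (Comp pf [Comp pp [Proj 1, Proj 0]])) [x] (LEAST y. P x y)"
      using computes_Mu_Least[where f = "f x", OF test] that by (simp add: f)
    show "computes (Comp pp [Proj 0, Mu (Comp pf [Comp pp [Proj 1, Proj 0]])]) [x]
        (pair x (LEAST y. P x y))"
      by (rule computes_Comp2[OF computes_Proj mu pp]) auto
    show "computes pg [pair x (LEAST y. P x y)] (g x (LEAST y. P x y))"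
      using pg[of "pair x (LEAST y. P x y)"] by simp
  qed
  then show ?thesis by blast
qed

lemma computable_Least_decidable:
  assumes "decidable (\<lambda>z. P (pfst z) (psnd z))" "\<And>x. \<exists>y. P x y"
  shows "computable (\<lambda>x. LEAST y. P x y)"
  using computes_search[OF assms(1), of "\<lambda>x y. y"] assms(2) computable_psnd[OF computable_id]
  unfolding computable_def by blast

lemma computable_div [comp_intros]:
  assumes "computable f" "computable g"
  shows "computable (\<lambda>x. f x div g x)"
proof -
  \<comment> \<open>The disjunct \<open>n = 0\<close> makes the search stop at 0, in agreement with
    \<open>m div 0 = 0\<close>.\<close>
  have "(LEAST y. n = 0 \<or> m < Suc y * n) = m div n" for m n :: nat
  proof (cases "n = 0")
    case False
    show ?thesis
    proof (rule Least_equality)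
      show "n = 0 \<or> m < Suc (m div n) * n"
        using False by (simp add: dividend_less_div_times)
      show "m div n \<le> y" if "n = 0 \<or> m < Suc y * n" for y
        using that False by (simp add: less_mult_imp_div_less flip: less_Suc_eq_le)
    qed
  qed auto
  moreover have "computable (\<lambda>x. LEAST y. g x = 0 \<or> f x < Suc y * g x)"
  proof (rule computable_Least_decidable)
    show "decidable (\<lambda>z. g (pfst z) = 0 \<or> f (pfst z) < Suc (psnd z) * g (pfst z))"
      by (intro comp_intros computable_comp[OF assms(1)] computable_comp[OF assms(2)])
    show "\<exists>y. g x = 0 \<or> f x < Suc y * g x" for x
      by (rule exI[of _ "f x"]) (cases "g x"; simp)
  qed
  ultimately show ?thesis by simp
qed

lemma computable_mod [comp_intros]:
  assumes "computable f" "computable g"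
  shows "computable (\<lambda>x. f x mod g x)"
  unfolding minus_div_mult_eq_mod[symmetric] by (intro comp_intros assms)

lemma decidable_even [comp_intros]: "computable f \<Longrightarrow> decidable (\<lambda>x. even (f x))"
  unfolding even_iff_mod_2_eq_zero by (intro comp_intros)

lemma decidable_mem_set_decode [comp_intros]:
  "computable f \<Longrightarrow> computable g \<Longrightarrow> decidable (\<lambda>x. f x \<in> set_decode (g x))"
  unfolding set_decode_def mem_Collect_eq by (intro comp_intros)

subsection \<open>Lists\<close>

lemma list_decode_pos: "c > 0 \<Longrightarrow> list_decode c = pfst (c - 1) # list_decode (psnd (c - 1))"
  by (cases c) (auto simp: pfst_def psnd_def split: prod.splits)

text \<open>The iterated state pairs the accumulator with the code of the remaining list. Tails have
  smaller codes, so \<open>c x\<close> iterations suffice, and the state is stationary once the list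
  is empty.\<close>

lemma computable_fold [comp_intros]:
  assumes "computable c" "computable a"
    "computable (\<lambda>z. h (pfst z) (pfst (psnd z)) (psnd (psnd z)))"
  shows "computable (\<lambda>x. fold (\<lambda>b r. h x b r) (list_decode (c x)) (a x))"
proof -
  define step where "step x s = (if psnd s = 0 then s
    else pair (h x (pfst (psnd s - 1)) (pfst s)) (psnd (psnd s - 1)))" for x s
  have iter: "psnd s \<le> n \<Longrightarrow> (step x ^^ n) s = pair (fold (h x) (list_decode (psnd s)) (pfst s)) 0"
    for x n s
  proof (induction n arbitrary: s)
    case 0
    then show ?case using pair_pfst_psnd[of s] by (simp del: pair_pfst_psnd)
  next
    case (Suc n)
    show ?case
    proof (cases "psnd s = 0")
      case True
      then have "step x s = s" by (simp add: step_def)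
      then show ?thesis using Suc.IH[of s] True by (simp add: funpow_swap1 step_def)
    next
      case False
      have "psnd (psnd s - 1) \<le> n" using psnd_le[of "psnd s - 1"] Suc.prems by linarith
      then show ?thesis using Suc.IH[of "step x s"] False
        by (simp add: step_def list_decode_pos funpow_Suc_right del: funpow.simps)
    qed
  qed
  have rec: "rec_nat s (\<lambda>_. step x) n = (step x ^^ n) s" for s x n
    by (induction n) auto
  have h: "computable (\<lambda>z. h (u z) (v z) (w z))"
    if "computable u" "computable v" "computable w" for u v w
    using computable_comp[OF assms(3) computable_pair[OF that(1) computable_pair[OF that(2,3)]]]
    by simp
  have "computable (\<lambda>x. pfst (rec_nat (pair (a x) (c x)) (\<lambda>_. step x) (c x)))"
    unfolding step_def by (intro comp_intros assms h)
  then show ?thesis unfolding rec by (simp add: iter)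
qed

lemma computable_sum_list [comp_intros]:
  assumes "computable c" "computable (\<lambda>z. f (pfst z) (psnd z))"
  shows "computable (\<lambda>x. \<Sum>b\<leftarrow>list_decode (c x). f x b)"
proof -
  have "fold (\<lambda>b r. r + g b) xs a = a + (\<Sum>b\<leftarrow>xs. g b)" for g :: "nat \<Rightarrow> nat" and xs a
    by (induction xs arbitrary: a) auto
  moreover have "computable (\<lambda>x. fold (\<lambda>b r. r + f x b) (list_decode (c x)) 0)"
    using computable_comp[OF assms(2), of "\<lambda>z. pair (pfst z) (pfst (psnd z))"]
    by (intro comp_intros assms) (simp add: comp_intros)
  ultimately show ?thesis by simp
qed

lemma decidable_Ball_list [comp_intros]:
  assumes "computable c" "decidable (\<lambda>z. P (pfst z) (psnd z))"
  shows "decidable (\<lambda>x. \<forall>b\<in>set (list_decode (c x)). P x b)"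
proof -
  have "(\<Sum>b\<leftarrow>xs. of_bool (\<not> Q b)) = (0::nat) \<longleftrightarrow> (\<forall>b\<in>set xs. Q b)" for Q :: "nat \<Rightarrow> bool" and xs
    by (induction xs) auto
  moreover have "decidable (\<lambda>x. (\<Sum>b\<leftarrow>list_decode (c x). of_bool (\<not> P x b)) = (0::nat))"
    using decidable_not[OF assms(2)] unfolding decidable_def[of "\<lambda>z. \<not> P (pfst z) (psnd z)"]
    by (intro comp_intros assms)
  ultimately show ?thesis by simp
qed

lemma decidable_mem_list [comp_intros]:
  assumes "computable c" "computable f"
  shows "decidable (\<lambda>x. f x \<in> set (list_decode (c x)))"
proof -
  have "decidable (\<lambda>x. \<not> (\<forall>b\<in>set (list_decode (c x)). \<not> b = f x))"
    by (intro comp_intros assms computable_comp[OF assms(2)])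
  then show ?thesis by (simp add: Bex_def)
qed

lemma nth_list_decode:
  "n < length (list_decode c) \<Longrightarrow> pfst (rec_nat c (\<lambda>_ r. psnd (r - 1)) n - 1) = list_decode c ! n"
proof -
  have drop: "list_decode (rec_nat c (\<lambda>_ r. psnd (r - 1)) n) = drop n (list_decode c)" for n
  proof (induction n)
    case (Suc n)
    let ?r = "rec_nat c (\<lambda>_ r. psnd (r - 1)) n"
    have "list_decode (psnd (?r - 1)) = tl (list_decode ?r)"
    proof (cases ?r)
      \<comment> \<open>The code 0 of the empty list is mapped to itself, which matches
        \<open>tl [] = []\<close>.\<close>
      case 0
      then show ?thesis by (simp add: psnd_def prod_decode_def prod_decode_aux.simps)
    next
      case (Suc m) then show ?thesis using list_decode_pos[of ?r] by simp
    qed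
    then show ?case using Suc by (simp add: drop_Suc tl_drop)
  qed simp
  assume n: "n < length (list_decode c)"
  then have "rec_nat c (\<lambda>_ r. psnd (r - 1)) n > 0"
    using drop[of n] by (cases "rec_nat c (\<lambda>_ r. psnd (r - 1)) n") auto
  from list_decode_pos[OF this] n show ?thesis
    using drop[of n] by (simp add: hd_drop_conv_nth flip: hd_drop_conv_nth) (metis list.sel(1))
qed

text \<open>Course-of-values recursion: the last argument of \<open>G\<close> codes the list of the previous
  values in reverse order.\<close>

lemma computable_course_of_values:
  assumes "computable n" "computable (\<lambda>z. G (pfst z) (pfst (psnd z)) (psnd (psnd z)))"
    and G: "\<And>x k. G x k (list_encode (rev (map (f x) [0..<k]))) = f x k"
  shows "computable (\<lambda>x. f x (n x))"
proof -
  have hist: "rec_nat 0 (\<lambda>k r. Suc (pair (G x k r) r)) m = list_encode (rev (map (f x) [0..<m]))" for x m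
    by (induction m) (auto simp: G pair_def)
  have "computable (\<lambda>x. pfst (rec_nat 0 (\<lambda>k r. Suc (pair (G x k r) r)) (Suc (n x)) - 1))"
    by (intro comp_intros assms)
  then show ?thesis unfolding hist by (simp add: pfst_def)
qed

section \<open>Evaluation of constraints on codes\<close>

text \<open>\<open>childc\<close> and \<open>rootc\<close> spell out the instance encoding as
  arithmetic; \<open>4 * t + 3\<close> is \<open>2 * (2 * t + 1) + 1\<close>, two right injections
  of \<open>sum_encode\<close>.\<close>

definition childc :: "nat \<Rightarrow> nat \<Rightarrow> nat" where "childc l t = Suc (2 * pair l t)"
definition rootc :: "nat \<Rightarrow> nat" where "rootc t = 4 * t + 3"
text \<open>\<open>fold\<close> puts the first letter of a word innermost. Prefixing
  \<open>a\<close> to a word thus amounts to replacing \<open>t\<close> by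
  \<open>childc a t\<close>, which is what makes the successor condition on windows local.\<close>

definition actc :: "nat \<Rightarrow> nat \<Rightarrow> nat" where "actc u t = fold childc (list_decode u) t"

text \<open>An assignment \<open>w\<close> maps codes of atoms to naturals; integer constants are scaled by \<open>q\<close>.\<close>

function evtc :: "nat \<Rightarrow> (nat \<Rightarrow> nat) \<Rightarrow> nat \<Rightarrow> nat" where
  "evtc q w h = (if even h then (if even (h div 2) then q * (h div 2 div 2) else w (h div 2))
     else evtc q w (pfst (h div 2)) + evtc q w (psnd (h div 2)))"
  by auto
termination
proof (relation "Wellfounded.measure (\<lambda>(q, w, h). h)")
  fix h :: nat assume "odd h"
  then have "h div 2 < h" by (cases h) auto
  then show "((q, w, pfst (h div 2)), (q, w, h)) \<in> Wellfounded.measure (\<lambda>(q, w, h). h)"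
    and "((q, w, psnd (h div 2)), (q, w, h)) \<in> Wellfounded.measure (\<lambda>(q, w, h). h)"
    for q :: nat and w :: "nat \<Rightarrow> nat"
    using pfst_le[of "h div 2"] psnd_le[of "h div 2"] by auto
qed simp

declare evtc.simps [simp del]

text \<open>Values from \<Omega> upwards count as infinite: the cap lets an infinite left side
  dominate everything. \<open>tol\<close> absorbs rounding errors.\<close>

definition acokc :: "nat \<Rightarrow> (nat \<Rightarrow> nat) \<Rightarrow> nat \<Rightarrow> nat \<Rightarrow> nat \<Rightarrow> bool" where
  "acokc q w \<Omega> tol c \<longleftrightarrow> min \<Omega> (evtc q w (psnd c)) \<le> evtc q w (pfst c) + tol"

definition tcokc :: "(nat \<Rightarrow> nat) \<Rightarrow> nat \<Rightarrow> nat \<Rightarrow> nat \<Rightarrow> nat \<Rightarrow> bool" where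
  "tcokc w \<Omega> tol u c \<longleftrightarrow>
     min \<Omega> (\<Sum>s\<leftarrow>list_decode (psnd c). w (rootc (actc u s))) \<le> w (rootc (actc u (pfst c))) + tol"

text \<open>A term only mentions atoms of smaller or equal code, so finite tables are enough for
  evaluating it.\<close>

lemma evtc_cong: "(\<And>i. i \<le> h \<Longrightarrow> w i = w' i) \<Longrightarrow> evtc q w h = evtc q w' h"
proof (induction h rule: less_induct)
  case (less h)
  have "evtc q w g = evtc q w' g" if "g < h" for g
    by (rule less.IH[OF that]) (use that less.prems in auto)
  moreover have "pfst (h div 2) < h" "psnd (h div 2) < h" if "odd h"
    using that pfst_le[of "h div 2"] psnd_le[of "h div 2"] by (cases h; auto)+
  ultimately show ?case using less.prems[of "h div 2"]
    by (auto simp: evtc.simps[of q w h] evtc.simps[of q w' h])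
qed

lemma enc_tree_Child: "enc_tree (Child l t) = childc l (enc_tree t)"
  by (simp add: childc_def pair_def sum_encode_def)

lemma enc_atom_Root: "enc_atom (Root t) = rootc (enc_tree t)"
  by (simp add: rootc_def sum_encode_def)

lemma fold_childc: "fold childc u (enc_tree t) = enc_tree (fold Child u t)"
  by (induction u arbitrary: t) (simp_all del: enc_tree.simps flip: enc_tree_Child)

lemma actc_list_encode [simp]: "actc (list_encode u) t = fold childc u t"
  by (simp add: actc_def)

lemma evtc_Const [simp]: "evtc q w (enc_term (Atom (Const n))) = q * n"
  by (subst evtc.simps) (simp add: sum_encode_def)

lemma evtc_AVar [simp]: "evtc q w (enc_term (Atom (AVar a))) = w (enc_atom (AVar a))"
  by (subst evtc.simps) (simp add: sum_encode_def)

lemma evtc_Root [simp]: "evtc q w (enc_term (Atom (Root t))) = w (enc_atom (Root t))"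
  by (subst evtc.simps) (simp add: sum_encode_def)

lemma evtc_Plus [simp]:
  "evtc q w (enc_term (Plus h h')) = evtc q w (enc_term h) + evtc q w (enc_term h')"
  by (subst evtc.simps) (simp add: sum_encode_def flip: pair_def)

lemma acokc_enc: "acokc q w \<Omega> tol (enc_ac (ArithGe h h')) \<longleftrightarrow>
    min \<Omega> (evtc q w (enc_term h')) \<le> evtc q w (enc_term h) + tol"
  by (simp add: acokc_def flip: pair_def)

lemma tcokc_enc: "tcokc w \<Omega> tol (list_encode u) (enc_tc (TreeGe t ts)) \<longleftrightarrow>
    min \<Omega> (\<Sum>s\<leftarrow>ts. w (rootc (enc_tree (fold Child u s)))) \<le> w (rootc (enc_tree (fold Child u t))) + tol"
  by (simp add: tcokc_def fold_childc o_def flip: pair_def)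

section \<open>Size bounds on codes\<close>

lemma add_le_pair: "a + b \<le> pair a b"
  by (cases "a + b") (simp_all add: pair_def prod_encode_def)

text \<open>Codes are superadditive, so they can serve as weights: error and size bounds
  proportional to the code pass from summands to the sum.\<close>

lemma enc_term_Plus_ge: "enc_term h + enc_term h' \<le> enc_term (Plus h h')"
  using add_le_pair[of "enc_term h" "enc_term h'"] by (simp add: sum_encode_def pair_def)

lemma enc_atom_le_enc_term: "2 * enc_atom v = enc_term (Atom v)"
  by (simp add: sum_encode_def)

lemma enc_term_le_enc_ac: "enc_term h \<le> enc_ac (ArithGe h h')" "enc_term h' \<le> enc_ac (ArithGe h h')"
  by (simp_all add: le_prod_encode_1 le_prod_encode_2)

lemma mem_le_list_encode: "x \<in> set xs \<Longrightarrow> x < list_encode xs"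
proof (induction xs)
  case (Cons y xs)
  then show ?case
    using le_prod_encode_1[of y "list_encode xs"] le_prod_encode_2[of "list_encode xs" y] by auto
qed simp

lemma enc_tree_le_enc_tc:
  "enc_tree t \<le> enc_tc (TreeGe t ts)" "s \<in> set ts \<Longrightarrow> enc_tree s \<le> enc_tc (TreeGe t ts)"
proof -
  show "enc_tree t \<le> enc_tc (TreeGe t ts)" by (simp add: le_prod_encode_1)
  assume "s \<in> set ts"
  then have "enc_tree s < list_encode (map enc_tree ts)" by (intro mem_le_list_encode) simp
  also have "\<dots> \<le> enc_tc (TreeGe t ts)" by (simp add: le_prod_encode_2)
  finally show "enc_tree s \<le> enc_tc (TreeGe t ts)" by simp
qed

lemma pfst_psnd_enc_instance:
  "pfst (enc_instance L AC TC) = list_encode L"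
  "pfst (psnd (enc_instance L AC TC)) = list_encode (map enc_ac AC)"
  "psnd (psnd (enc_instance L AC TC)) = list_encode (map enc_tc TC)"
  by (simp_all add: enc_instance_def flip: pair_def)

lemma enc_instance_ge:
  "c \<in> set AC \<Longrightarrow> enc_ac c \<le> enc_instance L AC TC"
  "d \<in> set TC \<Longrightarrow> enc_tc d \<le> enc_instance L AC TC"
proof -
  let ?e = "enc_instance L AC TC"
  have "pfst (psnd ?e) \<le> ?e" "psnd (psnd ?e) \<le> ?e"
    using pfst_le psnd_le le_trans by blast+
  then have *: "list_encode (map enc_ac AC) \<le> ?e" "list_encode (map enc_tc TC) \<le> ?e"
    by (simp_all add: pfst_psnd_enc_instance)
  show "enc_ac c \<le> ?e" if "c \<in> set AC"
    using mem_le_list_encode[of "enc_ac c" "map enc_ac AC"] that * by auto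
  show "enc_tc d \<le> ?e" if "d \<in> set TC"
    using mem_le_list_encode[of "enc_tc d" "map enc_tc TC"] that * by auto
qed

subsection \<open>Digit tables\<close>

text \<open>A number below \<open>b ^ n\<close> codes a table of \<open>n\<close> entries below
  \<open>b\<close>, so that quantifying over tables becomes bounded quantification over
  numbers.\<close>

definition dig :: "nat \<Rightarrow> nat \<Rightarrow> nat \<Rightarrow> nat" where "dig b \<tau> i = (\<tau> div b ^ i) mod b"

lemma dig_less: "b > 0 \<Longrightarrow> dig b \<tau> i < b"
  by (simp add: dig_def)

lemma ex_dig:
  assumes "\<And>i. i < n \<Longrightarrow> w i < b"
  shows "\<exists>\<tau><b ^ n. \<forall>i. dig b \<tau> i = (if i < n then w i else 0)"
  using assms
proof (induction n arbitrary: w)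
  case 0
  show ?case by (auto simp: dig_def)
next
  case (Suc n)
  have b: "w 0 < b" using Suc.prems by simp
  obtain \<tau> where \<tau>: "\<tau> < b ^ n" "\<And>i. dig b \<tau> i = (if i < n then w (Suc i) else 0)"
    using Suc.IH[of "\<lambda>i. w (Suc i)"] Suc.prems by auto
  let ?\<tau> = "w 0 + b * \<tau>"
  have "?\<tau> < b * Suc \<tau>" using b by simp
  also have "\<dots> \<le> b * b ^ n" using \<tau>(1) by (intro mult_le_mono) auto
  finally have "?\<tau> < b ^ Suc n" by simp
  moreover have "dig b ?\<tau> i = (if i < Suc n then w i else 0)" for i
  proof (cases i)
    case (Suc j)
    have "?\<tau> div b = \<tau>" using b by simp
    then have "dig b ?\<tau> (Suc j) = dig b \<tau> j" by (simp add: dig_def div_mult2_eq)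
    then show ?thesis using \<tau>(2) Suc by simp
  qed (use b in \<open>simp add: dig_def\<close>)
  ultimately show ?case by blast
qed

section \<open>Solutions with extended real values\<close>

primrec evE :: "(nat \<Rightarrow> ennreal) \<Rightarrow> nat arith_term \<Rightarrow> ennreal" where
  "evE X (Atom v) = (case v of Const n \<Rightarrow> of_nat n | _ \<Rightarrow> X (enc_atom v))"
| "evE X (Plus h h') = evE X h + evE X h'"

primrec real_ac :: "(nat \<Rightarrow> ennreal) \<Rightarrow> nat arith_constraint \<Rightarrow> bool" where
  "real_ac X (ArithGe h h') \<longleftrightarrow> evE X h' \<le> evE X h"

primrec real_tc :: "(nat \<Rightarrow> ennreal) \<Rightarrow> nat list \<Rightarrow> nat tree_constraint \<Rightarrow> bool" where
  "real_tc X u (TreeGe t ts) \<longleftrightarrow> (\<Sum>s\<leftarrow>ts. X (rootc (enc_tree (fold Child u s))))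
     \<le> X (rootc (enc_tree (fold Child u t)))"

text \<open>A solution with arbitrary extended real values, given as one function on codes of atoms.
  This value space is compact, unlike \<open>DD\<close>, and therefore admits limits.\<close>

definition rsol :: "nat set \<Rightarrow> nat arith_constraint set \<Rightarrow> nat tree_constraint set \<Rightarrow> (nat \<Rightarrow> ennreal) \<Rightarrow> bool"
  where "rsol L AC TC X \<longleftrightarrow> (\<forall>c\<in>AC. real_ac X c) \<and> (\<forall>u\<in>lists L. \<forall>c\<in>TC. real_tc X u c)"

lemma val_tree_foldr_Child: "val_tree \<mu> (foldr Child u t) w = val_tree \<mu> t (w @ u)"
  by (induction u arbitrary: w) (simp_all add: subtree_def)

lemma satisfiable_imp_rsol:
  assumes "satisfiable L AC TC"
  shows "\<exists>X. rsol L AC TC X"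
proof -
  obtain \<mu> \<nu> where AC: "\<And>c. c \<in> AC \<Longrightarrow> sat_ac \<mu> \<nu> c" and TC: "\<And>c. c \<in> TC \<Longrightarrow> sat_tc L \<mu> c"
    using assms unfolding satisfiable_def by blast
  define X where "X i = val_atom \<mu> \<nu> (inv enc_atom i)" for i
  have X: "X (enc_atom v) = val_atom \<mu> \<nu> v" for v
    unfolding X_def by (simp add: inv_f_f injI enc_atom_inj)
  have ev: "evE X h = val_term \<mu> \<nu> h" for h
  proof (induction h)
    case (Atom v)
    then show ?case by (cases v) (simp_all add: X del: enc_atom.simps)
  qed simp
  have "real_ac X c" if "c \<in> AC" for c using AC[OF that] by (cases c) (simp add: ev)
  moreover have "real_tc X u c" if "c \<in> TC" "u \<in> lists L" for c u
  proof (cases c)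
    case (TreeGe t ts)
    have "X (rootc (enc_tree (fold Child u t))) = val_tree \<mu> t (rev u)" for t
      using X[of "Root (fold Child u t)"] val_tree_foldr_Child[of \<mu> "rev u" t "[]"]
      by (simp add: enc_atom_Root root_val_def foldr_conv_fold del: enc_atom.simps)
    \<comment> \<open>\<open>fold\<close> makes the last letter outermost, while a tree is indexed
      by the word read from the outermost letter inwards.\<close>
    moreover have "rev u \<in> lists L" using that(2) by (simp add: in_lists_conv_set)
    ultimately show ?thesis using TC[OF that(1)] TreeGe by (simp add: root_val_subtree_at)
  qed
  ultimately show ?thesis unfolding rsol_def by blast
qed

lemma rsol_imp_satisfiable:
  assumes "rsol L AC TC X" and DD: "\<And>i. X i \<in> DD"
  shows "satisfiable L AC TC"
proof -
  define \<mu> where "\<mu> x w = X (rootc (enc_tree (foldr Child w (TVar x))))" for x w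
  define \<nu> where "\<nu> a = X (enc_atom (AVar a))" for a
  have \<mu>: "val_tree \<mu> t w = X (rootc (enc_tree (foldr Child w t)))" for t w
    by (induction t arbitrary: w) (simp_all add: \<mu>_def subtree_def del: enc_tree.simps)
  have ev: "evE X h = val_term \<mu> \<nu> h" for h
  proof (induction h)
    case (Atom v)
    show ?case
    proof (cases v)
      case (Root t)
      then show ?thesis using \<mu>[of t "[]"] enc_atom_Root[of t] by (simp add: root_val_def)
    qed (simp_all add: \<nu>_def)
  qed simp
  have "sat_ac \<mu> \<nu> c" if "c \<in> AC" for c
    using assms(1) that by (cases c) (force simp: rsol_def ev)
  moreover have "sat_tc L \<mu> c" if "c \<in> TC" for c
  proof (cases c)
    case (TreeGe t ts)
    have "(\<Sum>s\<leftarrow>ts. val_tree \<mu> s u) \<le> val_tree \<mu> t u" if "u \<in> lists L" for u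
    proof -
      have "rev u \<in> lists L" using that by (simp add: in_lists_conv_set)
      then have "real_tc X (rev u) c" using assms(1) \<open>c \<in> TC\<close> by (simp add: rsol_def)
      then show ?thesis using TreeGe by (simp add: \<mu> foldr_conv_fold)
    qed
    then show ?thesis using TreeGe by (simp add: root_val_subtree_at)
  qed
  moreover have "is_tree L (\<mu> x)" "\<nu> a \<in> DD" for x a
    by (simp_all only: is_tree_def \<mu>_def \<nu>_def DD ball_triv) simp_all
  ultimately show ?thesis unfolding satisfiable_def by blast
qed

section \<open>Discretization\<close>

text \<open>The floor of \<open>lam * x\<close> truncated at \<open>K\<close>. The maximum also
  covers an infinite product, which yields \<open>K\<close>.\<close>

definition grid :: "ennreal \<Rightarrow> nat \<Rightarrow> ennreal \<Rightarrow> nat" where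
  "grid lam K x = Max {k. k \<le> K \<and> of_nat k \<le> lam * x}"

lemma le_grid_iff: "k \<le> grid lam K x \<longleftrightarrow> k \<le> K \<and> of_nat k \<le> lam * x"
proof -
  let ?S = "{k. k \<le> K \<and> of_nat k \<le> lam * x}"
  have S: "finite ?S" "?S \<noteq> {}" by (auto intro: exI[of _ 0])
  have "grid lam K x \<in> ?S" unfolding grid_def by (rule Max_in[OF S])
  moreover have "k \<le> grid lam K x" if "k \<in> ?S" for k
    unfolding grid_def by (rule Max_ge[OF S(1) that])
  ultimately show ?thesis by (auto intro: order_trans[OF of_nat_mono])
qed

lemma grid_le: "grid lam K x \<le> K" and of_nat_grid_le: "of_nat (grid lam K x) \<le> lam * x"
  using le_grid_iff[of "grid lam K x" lam K x] by auto

lemma less_Suc_grid: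
  assumes "grid lam K x < K"
  shows "lam * x < of_nat (Suc (grid lam K x))"
proof (rule ccontr)
  assume "\<not> ?thesis"
  then have "Suc (grid lam K x) \<le> grid lam K x"
    using assms by (subst le_grid_iff) (simp add: not_less del: of_nat_Suc)
  then show False by simp
qed

text \<open>The digit \<open>K\<close> of a table stands for infinity and is evaluated as a large number \<open>\<Omega>\<close>.\<close>

definition inft :: "nat \<Rightarrow> nat \<Rightarrow> (nat \<Rightarrow> nat) \<Rightarrow> nat \<Rightarrow> nat" where
  "inft K \<Omega> w i = (if w i = K then \<Omega> else w i)"

lemma inft_same [simp]: "inft K K w = w"
  by (auto simp: inft_def)

text \<open>The function \<open>x \<mapsto> \<lfloor>lam * x\<rfloor>\<close> is superadditive, so rounding preserves constraints
  with a single summand on the greater side.\<close>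

lemma grid_superadditive:
  assumes "(\<Sum>s\<leftarrow>xs. X s) \<le> X x" "\<Omega> \<ge> K"
  shows "min \<Omega> (\<Sum>s\<leftarrow>xs. inft K \<Omega> (\<lambda>i. grid lam K (X i)) s) \<le> inft K \<Omega> (\<lambda>i. grid lam K (X i)) x"
proof (cases "grid lam K (X x) = K")
  \<comment> \<open>If the greater side has digit \<open>K\<close>, it evaluates to \<Omega> and the
    cap settles the claim. Here it is below \<open>K\<close>; each scaled summand is bounded by the
    scaled greater side, so no summand is truncated either.\<close>
  case False
  then have less: "grid lam K (X x) < K" using grid_le[of lam K "X x"] by simp
  have sum: "(\<Sum>s\<leftarrow>xs. lam * X s) \<le> lam * X x"
    using mult_left_mono[OF assms(1), of lam] by (simp add: sum_list_const_mult)
  have "lam * X s \<le> lam * X x" if "s \<in> set xs" for s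
    using member_le_sum_list[of "lam * X s" "map (\<lambda>s. lam * X s) xs"] that sum by (auto intro: order_trans)
  then have "of_nat (grid lam K (X s)) < (of_nat K :: ennreal)" if "s \<in> set xs" for s
    using of_nat_grid_le[of lam K "X s"] less_Suc_grid[OF less] that less
    by (meson Suc_leI of_nat_mono order_le_less_trans order_less_le_trans order_trans)
  then have neq: "grid lam K (X s) \<noteq> K" if "s \<in> set xs" for s using that by fastforce
  then have eq: "(\<Sum>s\<leftarrow>xs. inft K \<Omega> (\<lambda>i. grid lam K (X i)) s) = (\<Sum>s\<leftarrow>xs. grid lam K (X s))"
    by (intro arg_cong[where f = sum_list] map_cong) (auto simp: inft_def)
  have "of_nat (\<Sum>s\<leftarrow>xs. grid lam K (X s)) = (\<Sum>s\<leftarrow>xs. of_nat (grid lam K (X s)) :: ennreal)"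
    by (induction xs) auto
  also have "\<dots> \<le> (\<Sum>s\<leftarrow>xs. lam * X s)" by (intro sum_list_mono of_nat_grid_le)
  finally have le: "of_nat (\<Sum>s\<leftarrow>xs. grid lam K (X s)) \<le> lam * X x" using sum by simp
  also have "\<dots> < of_nat (Suc (grid lam K (X x)))" by (rule less_Suc_grid[OF less])
  finally have "(\<Sum>s\<leftarrow>xs. grid lam K (X s)) \<le> grid lam K (X x)"
    unfolding of_nat_less_iff by simp
  then show ?thesis unfolding eq using False by (auto simp: inft_def)
qed (auto simp: inft_def)

lemma evtc_upper:
  assumes "\<And>i. i \<le> e \<Longrightarrow> of_nat (w i) \<le> lam * X i" "of_nat q \<le> lam" "enc_term h \<le> e"
  shows "of_nat (evtc q w (enc_term h)) \<le> lam * evE X h"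
  using assms(3)
proof (induction h)
  case (Atom v)
  have i: "of_nat (w (enc_atom v)) \<le> lam * X (enc_atom v)"
    using Atom enc_atom_le_enc_term[of v] by (intro assms(1)) linarith
  show ?case
  proof (cases v)
    case (Const n)
    then show ?thesis using mult_right_mono[OF assms(2), of "of_nat n"]
      by (simp del: enc_term.simps)
  qed (use i in \<open>simp_all del: enc_atom.simps enc_term.simps\<close>)
next
  case (Plus h h')
  then show ?case using enc_term_Plus_ge[of h h'] add_mono[of _ "lam * evE X h" _ "lam * evE X h'"]
    by (simp add: distrib_left del: enc_term.simps)
qed

text \<open>Rounding down costs at most \<delta> per variable or root, and a constant
  \<open>n\<close> costs at most \<delta> times \<open>n\<close>. The code of the term bounds the
  total weight, unless the evaluation overflows to \<Omega>.\<close>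

lemma evtc_lower:
  assumes "\<And>i. i \<le> e \<Longrightarrow> \<Omega> \<le> w i \<or> lam * X i \<le> of_nat (w i) + \<delta>" "lam \<le> of_nat q + \<delta>"
    "enc_term h \<le> e"
  shows "\<Omega> \<le> evtc q w (enc_term h) \<or> lam * evE X h \<le> of_nat (evtc q w (enc_term h)) + \<delta> * of_nat (enc_term h)"
  using assms(3)
proof (induction h)
  case (Atom v)
  have i: "\<Omega> \<le> w (enc_atom v) \<or> lam * X (enc_atom v) \<le> of_nat (w (enc_atom v)) + \<delta>"
    using Atom enc_atom_le_enc_term[of v] by (intro assms(1)) linarith
  \<comment> \<open>Only \<open>Const 0\<close> has code 0; every other atom has a code large enough
    to pay for one \<delta>.\<close>
  have d: "\<delta> \<le> \<delta> * of_nat (enc_term (Atom v))" if "enc_atom v > 0"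
  proof -
    have "(1::ennreal) \<le> of_nat (enc_term (Atom v))"
      using that enc_atom_le_enc_term[of v] of_nat_mono[of 1 "enc_term (Atom v)"] by (simp del: enc_term.simps)
    then show ?thesis using mult_left_mono[of 1 _ \<delta>] by force
  qed
  show ?case
  proof (cases v)
    case (Const n)
    have "lam * of_nat n \<le> (of_nat q + \<delta>) * of_nat n" by (rule mult_right_mono[OF assms(2)]) simp
    also have "\<dots> = of_nat (q * n) + \<delta> * of_nat n" by (simp add: distrib_right)
    also have "\<delta> * of_nat n \<le> \<delta> * of_nat (enc_term (Atom (Const n)))"
      by (intro mult_left_mono of_nat_mono) (auto simp: sum_encode_def)
    finally show ?thesis using Const by (simp add: add_left_mono del: enc_term.simps)
  next
    case (AVar a)
    have "enc_atom v > 0" using AVar by (simp add: sum_encode_def)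
    from d[OF this] show ?thesis using i AVar
      by (auto simp del: enc_atom.simps enc_term.simps intro: order_trans add_left_mono)
  next
    case (Root t)
    have "enc_atom v > 0" using Root by (simp add: sum_encode_def)
    from d[OF this] show ?thesis using i Root
      by (auto simp del: enc_atom.simps enc_term.simps intro: order_trans add_left_mono)
  qed
next
  case (Plus h h')
  have le: "enc_term h + enc_term h' \<le> enc_term (Plus h h')" by (rule enc_term_Plus_ge)
  let ?E = "evtc q w"
  show ?case
  proof (cases "\<Omega> \<le> ?E (enc_term h) \<or> \<Omega> \<le> ?E (enc_term h')")
    case False
    then have "lam * evE X h \<le> of_nat (?E (enc_term h)) + \<delta> * of_nat (enc_term h)"
      "lam * evE X h' \<le> of_nat (?E (enc_term h')) + \<delta> * of_nat (enc_term h')"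
      using Plus le by auto
    from add_mono[OF this] have "lam * evE X (Plus h h') \<le> of_nat (?E (enc_term (Plus h h')))
        + \<delta> * of_nat (enc_term h + enc_term h')"
      by (simp add: distrib_left ac_simps del: enc_term.simps)
    also have "\<delta> * of_nat (enc_term h + enc_term h') \<le> \<delta> * of_nat (enc_term (Plus h h'))"
      by (intro mult_left_mono of_nat_mono le) simp
    finally show ?thesis by (simp add: add_left_mono del: enc_term.simps)
  qed (auto simp del: enc_term.simps)
qed

text \<open>The smaller side is underestimated and the greater side loses less than
  \<open>tol + 1\<close>. Both evaluations are integers, so the strict estimate becomes an
  inequality with tolerance \<open>tol\<close>.\<close>

lemma acokc_approx:
  assumes "real_ac X c" "enc_ac c \<le> e"
    and "\<And>i. i \<le> e \<Longrightarrow> of_nat (w i) \<le> lam * X i" "of_nat q \<le> lam"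
    and "\<And>i. i \<le> e \<Longrightarrow> \<Omega> \<le> w i \<or> lam * X i \<le> of_nat (w i) + \<delta>" "lam \<le> of_nat q + \<delta>"
    and tol: "\<delta> * of_nat e < of_nat (Suc tol)"
  shows "acokc q w \<Omega> tol (enc_ac c)"
proof (cases c)
  case (ArithGe h h')
  have le: "enc_term h \<le> e" "enc_term h' \<le> e" using enc_term_le_enc_ac(1)[of h h'] enc_term_le_enc_ac(2)[of h' h] assms(2) ArithGe by simp_all
  show ?thesis
  proof (cases "\<Omega> \<le> evtc q w (enc_term h)")
    case False
    have "of_nat (evtc q w (enc_term h')) \<le> lam * evE X h'"
      by (rule evtc_upper) (use assms le in auto)
    also have "\<dots> \<le> lam * evE X h"
      by (rule mult_left_mono) (use assms(1) ArithGe in auto)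
    also have "\<dots> \<le> of_nat (evtc q w (enc_term h)) + \<delta> * of_nat (enc_term h)"
      using evtc_lower[of e \<Omega> w lam X \<delta> q h] assms le False by blast
    also have "\<dots> \<le> of_nat (evtc q w (enc_term h)) + \<delta> * of_nat e"
      by (intro add_left_mono mult_left_mono of_nat_mono le) simp
    also have "\<dots> < of_nat (evtc q w (enc_term h)) + of_nat (Suc tol)"
      using tol by (simp add: ennreal_add_left_cancel_less del: of_nat_Suc)
    also have "\<dots> = of_nat (evtc q w (enc_term h) + Suc tol)" by simp
    finally show ?thesis unfolding of_nat_less_iff ArithGe acokc_enc by simp
  qed (simp add: ArithGe acokc_enc del: enc_ac.simps)
qed

lemma tcokc_grid:
  assumes "real_tc X u c" "\<Omega> \<ge> K"
  shows "tcokc (inft K \<Omega> (\<lambda>i. grid lam K (X i))) \<Omega> tol (list_encode u) (enc_tc c)"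
proof (cases c)
  case (TreeGe t ts)
  have "(\<Sum>s\<leftarrow>map (\<lambda>s. rootc (enc_tree (fold Child u s))) ts. X s) \<le> X (rootc (enc_tree (fold Child u t)))"
    using assms(1) TreeGe by (simp add: o_def)
  from grid_superadditive[OF this assms(2), of lam] show ?thesis
    unfolding TreeGe tcokc_enc by (simp add: o_def)
qed

text \<open>Makes refutations sound. At scale \<open>n\<close>, rounding loses at most 1 per atom,
  hence at most \<open>e\<close> in an arithmetic constraint, and nothing in a tree
  constraint.\<close>

lemma relaxed_of_rsol:
  assumes "rsol L AC TC X" "n \<ge> 1" and e: "\<And>c. c \<in> AC \<Longrightarrow> enc_ac c \<le> e"
  shows "\<exists>\<tau> < (n\<^sup>2 + 1) ^ (n + e + 1).
     (\<forall>c\<in>AC. acokc n (dig (n\<^sup>2 + 1) \<tau>) (n\<^sup>2) (e + 1) (enc_ac c)) \<and>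
     (\<forall>u\<in>lists L. \<forall>c\<in>TC. rootc (actc (list_encode u) (pfst (enc_tc c))) < n + e + 1 \<longrightarrow>
        tcokc (dig (n\<^sup>2 + 1) \<tau>) (n\<^sup>2) (e + 1) (list_encode u) (enc_tc c))"
proof -
  let ?b = "n\<^sup>2 + 1" and ?N = "n + e + 1"
  \<comment> \<open>Cutting \<open>X\<close> off to 0 gives a finite table. Arithmetic atoms lie
    below the cut, and a tree constraint survives whenever its greater side does, since only its
    summands can shrink.\<close>
  define X' where "X' i = (if i < ?N then X i else 0)" for i
  define w where "w i = grid (of_nat n) (n\<^sup>2) (X' i)" for i
  have w0: "w i = 0" if "i \<ge> ?N" for i
    using of_nat_grid_le[of "of_nat n" "n\<^sup>2" "X' i"] that by (simp add: w_def X'_def)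
  obtain \<tau> where \<tau>: "\<tau> < ?b ^ ?N" "\<And>i. dig ?b \<tau> i = (if i < ?N then w i else 0)"
    using ex_dig[of ?N w ?b] grid_le by (auto simp: w_def less_Suc_eq_le)
  then have dig: "dig ?b \<tau> = w" using w0 by fastforce
  have "acokc n w (n\<^sup>2) (e + 1) (enc_ac c)" if "c \<in> AC" for c
  proof (rule acokc_approx[where lam = "of_nat n" and e = e and \<delta> = 1 and X = X])
    fix i assume "i \<le> e"
    then have X: "X' i = X i" by (simp add: X'_def)
    show "of_nat (w i) \<le> of_nat n * X i"
      using of_nat_grid_le[of "of_nat n" "n\<^sup>2" "X i"] by (simp add: w_def X)
    show "n\<^sup>2 \<le> w i \<or> of_nat n * X i \<le> of_nat (w i) + 1"
      using less_Suc_grid[of "of_nat n" "n\<^sup>2" "X i"]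
      by (cases "grid (of_nat n) (n\<^sup>2) (X i) < n\<^sup>2") (auto simp: w_def X add.commute less_imp_le)
  qed (use assms(1) that e in \<open>auto simp: rsol_def simp flip: of_nat_Suc simp del: of_nat_Suc\<close>)
  moreover have "tcokc w (n\<^sup>2) (e + 1) (list_encode u) (enc_tc c)"
    if "u \<in> lists L" "c \<in> TC" "rootc (actc (list_encode u) (pfst (enc_tc c))) < ?N" for u c
  proof -
    obtain t ts where c: "c = TreeGe t ts" by (cases c)
    have "real_tc X u c" using assms(1) that by (simp add: rsol_def)
    moreover have "rootc (enc_tree (fold Child u t)) < ?N"
      using that(3) by (simp add: c fold_childc flip: pair_def)
    moreover have "(\<Sum>s\<leftarrow>ts. X' (rootc (enc_tree (fold Child u s)))) \<le> (\<Sum>s\<leftarrow>ts. X (rootc (enc_tree (fold Child u s))))"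
      by (intro sum_list_mono) (simp add: X'_def)
    ultimately have "real_tc X' u c" by (simp add: c X'_def)
    from tcokc_grid[OF this order_refl[of "n\<^sup>2"], of "of_nat n"]
    show ?thesis by (simp flip: w_def)
  qed
  ultimately show ?thesis using \<tau>(1) unfolding dig[symmetric] by blast
qed

subsection \<open>Exact rounding\<close>

text \<open>Moving the common denominator \<open>q\<close> of a simultaneous approximation slightly upwards
  places all multiples just above integers.\<close>

lemma approx_from_above:
  fixes x :: "nat \<Rightarrow> real" and \<epsilon> :: real
  assumes "\<And>i. i < m \<Longrightarrow> x i > 0" "\<epsilon> > 0"
  shows "\<exists>q lam. q \<ge> (1::nat) \<and> real q \<le> lam \<and> lam \<le> q + \<epsilon> \<and>
    (\<forall>i<m. \<exists>p::int. p \<le> lam * x i \<and> lam * x i \<le> p + \<epsilon>)"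
proof -
  \<comment> \<open>Inserting 1 keeps the extrema defined when \<open>m = 0\<close>.\<close>
  define lo where "lo = Min (insert 1 (x ` {..<m}))"
  define hi where "hi = Max (insert 1 (x ` {..<m}))"
  have lo: "lo > 0" "i < m \<Longrightarrow> lo \<le> x i" for i
    using assms(1) by (auto simp: lo_def)
  have hi: "hi > 0" "i < m \<Longrightarrow> x i \<le> hi" for i
    by (auto simp: hi_def less_le_trans[OF zero_less_one Max_ge])
  \<comment> \<open>\<open>N\<close> makes the Dirichlet error, the largest shift
    \<open>hi * \<eta>\<close> and \<eta> itself together at most \<epsilon>.\<close>
  obtain N :: nat where N: "(1 + hi / lo + 1 / lo) / \<epsilon> < real N" using reals_Archimedean2 by blast
  have pos: "0 < (1 + hi / lo + 1 / lo) / \<epsilon>" using lo hi assms(2) by (simp add: add_pos_pos)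
  then have N0: "N > 0" using N by (cases N) auto
  obtain q p where q: "0 < q" and p: "\<And>i. i < m \<Longrightarrow> \<bar>of_int q * x i - of_int (p i)\<bar> < 1 / N"
    using Dirichlet_approx_simult[OF N0, of m x] by metis
  \<comment> \<open>Since \<open>\<eta> * lo = 1 / N\<close>, adding \<eta> to \<open>q\<close>
    raises every multiple by at least the Dirichlet error, hence not below its integer.\<close>
  define \<eta> where "\<eta> = 1 / (N * lo)"
  have bound: "1 / N + hi * \<eta> + \<eta> \<le> \<epsilon>"
  proof -
    have "1 / N + hi * \<eta> + \<eta> = (1 + hi / lo + 1 / lo) / N"
      using N0 lo by (simp add: \<eta>_def field_simps)
    also have "\<dots> \<le> \<epsilon>" using N N0 assms(2) by (simp add: field_simps)
    finally show ?thesis .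
  qed
  have \<eta>: "\<eta> > 0" using N0 lo by (simp add: \<eta>_def)
  have "of_int (p i) \<le> (q + \<eta>) * x i \<and> (q + \<eta>) * x i \<le> of_int (p i) + \<epsilon>" if "i < m" for i
  proof
    have "1 / N = \<eta> * lo" using lo by (simp add: \<eta>_def)
    also have "\<dots> \<le> \<eta> * x i" using lo(2)[OF that] \<eta> by simp
    finally show "of_int (p i) \<le> (q + \<eta>) * x i" using p[OF that] by (simp add: distrib_right)
    have "\<eta> * x i \<le> hi * \<eta>" using hi(2)[OF that] \<eta> by (simp add: mult.commute)
    then show "(q + \<eta>) * x i \<le> of_int (p i) + \<epsilon>"
      using p[OF that] bound \<eta> unfolding distrib_right by linarith
  qed
  moreover have "\<eta> \<le> \<epsilon>" using bound hi \<eta> N0 by (smt (verit) divide_nonneg_nonneg mult_nonneg_nonneg of_nat_0_le_iff)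
  ultimately show ?thesis
    using q \<eta> by (intro exI[of _ "nat q"] exI[of _ "q + \<eta>"]) auto
qed

text \<open>With accumulated error \<open>\<epsilon> * e\<close> below 1, integrality leaves
  tolerance 0. \<Omega> stays arbitrary because its later value depends on \<open>q\<close> and
  \<open>K\<close>.\<close>

lemma exact_of_rsol:
  assumes "rsol L AC TC X" and e: "\<And>c. c \<in> AC \<Longrightarrow> enc_ac c \<le> e"
  shows "\<exists>q K w. q \<ge> 1 \<and> (\<forall>i. w i \<le> K) \<and> (\<forall>\<Omega>\<ge>K.
     (\<forall>c\<in>AC. acokc q (inft K \<Omega> w) \<Omega> 0 (enc_ac c)) \<and>
     (\<forall>u\<in>lists L. \<forall>c\<in>TC. tcokc (inft K \<Omega> w) \<Omega> 0 (list_encode u) (enc_tc c)))"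
proof -
  \<comment> \<open>Simultaneous approximation needs positive finite reals. Zero and infinity are
    preserved by every positive scale, so a placeholder 1 does no harm.\<close>
  define x where "x i = (if X i = 0 \<or> X i = top then 1 else enn2real (X i))" for i
  define \<epsilon> :: real where "\<epsilon> = 1 / (real e + 1)"
  have x: "x i > 0" for i by (simp add: x_def enn2real_positive_iff less_top zero_less_iff_neq_zero)
  have \<epsilon>: "\<epsilon> > 0" "\<epsilon> \<le> 1" "\<epsilon> * e < 1" by (auto simp: \<epsilon>_def field_simps)
  obtain q lam where q: "q \<ge> 1" "real q \<le> lam" "lam \<le> q + \<epsilon>"
    and p: "\<And>i. i < Suc e \<Longrightarrow> \<exists>p::int. p \<le> lam * x i \<and> lam * x i \<le> p + \<epsilon>"
    using approx_from_above[of "Suc e" x \<epsilon>] x \<epsilon>(1) by blast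
  have lam: "lam > 0" using q by linarith
  \<comment> \<open>\<open>K\<close> exceeds all scaled finite values, so among the atoms up to
    \<open>e\<close> the digit \<open>K\<close> arises exactly from infinity.\<close>
  obtain K :: nat where K: "\<And>i. i \<le> e \<Longrightarrow> lam * x i < K"
  proof -
    obtain K where "Max ((\<lambda>i. lam * x i) ` {..e}) < real K" using reals_Archimedean2 by blast
    then show ?thesis by (intro that[of K]) (auto simp: Max_less_iff)
  qed
  define w where "w i = grid (ennreal lam) K (X i)" for i
  have fin: "X i = ennreal (x i)" if "X i \<noteq> 0" "X i \<noteq> top" for i
    using that by (simp add: x_def less_top)
  have "acokc q (inft K \<Omega> w) \<Omega> 0 (enc_ac c)" if "c \<in> AC" "\<Omega> \<ge> K" for \<Omega> c
  proof (rule acokc_approx[where lam = "ennreal lam" and e = e and \<delta> = "ennreal \<epsilon>" and X = X])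
    fix i assume i: "i \<le> e"
    consider "X i = 0" | "X i = top" | "X i \<noteq> 0" "X i \<noteq> top" by blast
    then have "of_nat (inft K \<Omega> w i) \<le> ennreal lam * X i \<and>
      (\<Omega> \<le> inft K \<Omega> w i \<or> ennreal lam * X i \<le> of_nat (inft K \<Omega> w i) + ennreal \<epsilon>)"
    proof cases
      case 1
      have "K > 0" using K[OF i] x[of i] lam by (cases K) (auto simp: not_less mult_less_0_iff)
      moreover have "w i = 0" using of_nat_grid_le[of "ennreal lam" K "X i"] 1 by (simp add: w_def)
      ultimately show ?thesis using 1 by (simp add: inft_def)
    next
      case 2
      have "ennreal lam * X i = top" using 2 lam by (simp add: ennreal_mult_top)
      moreover from this have "K \<le> w i" unfolding w_def le_grid_iff by simp
      then have "w i = K" using grid_le[of "ennreal lam" K "X i"] by (simp add: w_def)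
      ultimately show ?thesis by (simp add: inft_def)
    next
      case 3
      have eq: "ennreal lam * X i = ennreal (lam * x i)"
        using fin[OF 3] lam x[of i] by (simp add: ennreal_mult less_imp_le)
      have "of_nat (w i) \<le> ennreal (lam * x i)"
        using of_nat_grid_le[of "ennreal lam" K "X i"] eq by (simp add: w_def)
      then have wle: "real (w i) \<le> lam * x i" using lam x[of i]
        by (simp add: ennreal_of_nat_eq_real_of_nat)
      then have "w i < K" using K[OF i] by linarith
      then have ww: "inft K \<Omega> w i = w i" by (simp add: inft_def)
      obtain p :: int where p: "p \<le> lam * x i" "lam * x i \<le> p + \<epsilon>" using p[of i] i by auto
      have "p > -1"
      proof -
        have "0 < p + \<epsilon>" using p(2) lam x[of i] by (smt (verit) mult_pos_pos)
        then show ?thesis using \<epsilon>(2) by linarith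
      qed
      then have "nat p \<le> w i" unfolding w_def le_grid_iff eq
        using p K[OF i] by (auto simp: ennreal_of_nat_eq_real_of_nat intro!: ennreal_leI)
      then have "lam * x i \<le> real (w i) + \<epsilon>" using p \<open>p > -1\<close> by linarith
      then have "ennreal (lam * x i) \<le> of_nat (w i) + ennreal \<epsilon>"
        using \<epsilon>(1) by (simp add: ennreal_of_nat_eq_real_of_nat ennreal_leI flip: ennreal_plus)
      then show ?thesis
        using wle by (simp add: ww eq ennreal_of_nat_eq_real_of_nat ennreal_leI)
    qed
    then show "of_nat (inft K \<Omega> w i) \<le> ennreal lam * X i"
      "\<Omega> \<le> inft K \<Omega> w i \<or> ennreal lam * X i \<le> of_nat (inft K \<Omega> w i) + ennreal \<epsilon>" by simp_all
  next
    show "of_nat q \<le> ennreal lam" using q by (simp add: ennreal_of_nat_eq_real_of_nat ennreal_leI)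
    show "ennreal lam \<le> of_nat q + ennreal \<epsilon>"
      using q \<epsilon>(1) by (simp add: ennreal_of_nat_eq_real_of_nat ennreal_leI flip: ennreal_plus)
    have "ennreal (\<epsilon> * e) < ennreal 1" using \<epsilon> by (intro ennreal_lessI) auto
    then show "ennreal \<epsilon> * of_nat e < of_nat (Suc 0)"
      using \<epsilon> by (simp add: ennreal_of_nat_eq_real_of_nat ennreal_mult)
  qed (use assms(1) that e in \<open>auto simp: rsol_def\<close>)
  moreover have "tcokc (inft K \<Omega> w) \<Omega> 0 (list_encode u) (enc_tc c)"
    if "u \<in> lists L" "c \<in> TC" "\<Omega> \<ge> K" for \<Omega> u c
    unfolding w_def by (rule tcokc_grid) (use assms(1) that in \<open>auto simp: rsol_def\<close>)
  moreover have "w i \<le> K" for i unfolding w_def by (rule grid_le)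
  ultimately show ?thesis using q(1) by blast
qed

section \<open>Limits of relaxed solutions\<close>

text \<open>After division by \<open>N k\<close> the tolerance tends to 0 and the cap becomes
  \<open>N k\<close>, which tends to infinity; the limit inequality retains neither.\<close>

lemma le_of_relaxed_limit:
  assumes "(\<lambda>k. of_nat (a k) / of_nat (N k) :: ennreal) \<longlonglongrightarrow> A"
    and "(\<lambda>k. of_nat (b k) / of_nat (N k) :: ennreal) \<longlonglongrightarrow> B"
    and "strict_mono N" "\<And>k. N k > 0"
    and le: "eventually (\<lambda>k. min ((N k)\<^sup>2) (a k) \<le> b k + tol) sequentially"
  shows "A \<le> B"
proof -
  have N: "filterlim N at_top sequentially" by (rule filterlim_subseq[OF assms(3)])
  have top: "(\<lambda>k. of_nat (N k) :: ennreal) \<longlonglongrightarrow> top"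
    by (rule filterlim_compose[OF of_nat_tendsto_top_ennreal N])
  have "(\<lambda>k. ennreal (real tol / real (N k))) \<longlonglongrightarrow> ennreal 0"
    by (intro tendsto_ennrealI filterlim_compose[OF lim_const_over_n N])
  then have "(\<lambda>k. of_nat tol / of_nat (N k) :: ennreal) \<longlonglongrightarrow> 0"
    using assms(4) by (simp add: ennreal_of_nat_eq_real_of_nat divide_ennreal)
  from tendsto_add[OF assms(2) this]
  have R: "(\<lambda>k. of_nat (b k + tol) / of_nat (N k) :: ennreal) \<longlonglongrightarrow> B"
    by (simp add: add_divide_distrib_ennreal)
  have L: "(\<lambda>k. min (of_nat (N k)) (of_nat (a k) / of_nat (N k)) :: ennreal) \<longlonglongrightarrow> min top A"
    by (intro tendsto_min top assms(1))
  have "eventually (\<lambda>k. min (of_nat (N k)) (of_nat (a k) / of_nat (N k)) \<le>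
      (of_nat (b k + tol) / of_nat (N k) :: ennreal)) sequentially"
    using le
  proof eventually_elim
    case (elim k)
    have "of_nat (N k) = (of_nat ((N k)\<^sup>2) / of_nat (N k) :: ennreal)"
      using assms(4)[of k] by (simp add: power2_eq_square mult_divide_eq_ennreal)
    then have "min (of_nat (N k)) (of_nat (a k) / of_nat (N k)) \<le>
      (of_nat (min ((N k)\<^sup>2) (a k)) / of_nat (N k) :: ennreal)"
      by (cases "a k \<le> (N k)\<^sup>2") (auto simp: min_absorb1 min_absorb2 intro: min.coboundedI1)
    also have "\<dots> \<le> of_nat (b k + tol) / of_nat (N k)"
      by (intro divide_right_mono_ennreal of_nat_mono elim)
    finally show ?case .
  qed
  from tendsto_le[OF trivial_limit_sequentially R L this] show ?thesis by simp
qed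

lemma diagonal_limit:
  fixes S :: "nat \<Rightarrow> nat \<Rightarrow> ennreal"
  shows "\<exists>d X. strict_mono d \<and> (\<forall>i. (\<lambda>n. S (d n) i) \<longlonglongrightarrow> X i)"
proof -
  interpret subseqs "\<lambda>i r. convergent (\<lambda>n. S (r n) i)"
  proof
    fix i and s :: "nat \<Rightarrow> nat"
    obtain l r where "strict_mono r" "((\<lambda>n. S (s n) i) \<circ> r) \<longlonglongrightarrow> l"
      using compact_complete_linorder by blast
    then show "\<exists>r'. strict_mono r' \<and> convergent (\<lambda>n. S ((s \<circ> r') n) i)"
      by (auto simp: convergent_def o_def)
  qed
  have "convergent (\<lambda>n. S (diagseq n) i)" for i
  proof -
    \<comment> \<open>The diagonal sequence refines the one chosen for coordinate \<open>i\<close>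
      only from \<open>Suc i\<close> on; the offset is removed afterwards.\<close>
    have "convergent (\<lambda>n. S ((diagseq \<circ> (+) (Suc i)) n) i)"
    proof (rule diagseq_holds)
      fix r s :: "nat \<Rightarrow> nat" and k
      assume "strict_mono r" "convergent (\<lambda>n. S (s n) k)"
      then show "convergent (\<lambda>n. S ((s \<circ> r) n) k)"
        using LIMSEQ_subseq_LIMSEQ[of "\<lambda>n. S (s n) k" _ r] by (auto simp: convergent_def o_def)
    qed
    then obtain l where "(\<lambda>n. S (diagseq (n + Suc i)) i) \<longlonglongrightarrow> l"
      by (auto simp: convergent_def o_def add.commute)
    from LIMSEQ_offset[OF this] show ?thesis by (rule convergentI)
  qed
  then have "\<forall>i. \<exists>l. (\<lambda>n. S (diagseq n) i) \<longlonglongrightarrow> l" by (simp add: convergent_def)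
  then show ?thesis using subseq_diagseq by metis
qed

text \<open>Compactness: the tables divided by \<open>n\<close> converge pointwise along a
  subsequence, and each single constraint is among those checked for all large
  \<open>n\<close>.\<close>

lemma rsol_of_relaxed:
  assumes "\<And>n. n \<ge> 1 \<Longrightarrow> \<exists>w. (\<forall>c\<in>AC. acokc n w (n\<^sup>2) tol (enc_ac c)) \<and>
     (\<forall>u\<in>lists L. list_encode u < n \<longrightarrow> (\<forall>c\<in>TC. rootc (actc (list_encode u) (pfst (enc_tc c))) < n \<longrightarrow>
        tcokc w (n\<^sup>2) tol (list_encode u) (enc_tc c)))"
  shows "\<exists>X. rsol L AC TC X"
proof -
  have "\<forall>n. \<exists>w. (\<forall>c\<in>AC. acokc (Suc n) w ((Suc n)\<^sup>2) tol (enc_ac c)) \<and>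
     (\<forall>u\<in>lists L. list_encode u < Suc n \<longrightarrow> (\<forall>c\<in>TC. rootc (actc (list_encode u) (pfst (enc_tc c))) < Suc n \<longrightarrow>
        tcokc w ((Suc n)\<^sup>2) tol (list_encode u) (enc_tc c)))"
    using assms by (metis Suc_eq_plus1_left le_add1)
  then obtain w where ac: "\<And>n c. c \<in> AC \<Longrightarrow> acokc (Suc n) (w n) ((Suc n)\<^sup>2) tol (enc_ac c)"
    and tc: "\<And>n u c. u \<in> lists L \<Longrightarrow> list_encode u < Suc n \<Longrightarrow> c \<in> TC \<Longrightarrow>
        rootc (actc (list_encode u) (pfst (enc_tc c))) < Suc n \<Longrightarrow>
        tcokc (w n) ((Suc n)\<^sup>2) tol (list_encode u) (enc_tc c)"
    by metis
  obtain d X where d: "strict_mono d"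
    and X: "\<And>i. (\<lambda>n. of_nat (w (d n) i) / of_nat (Suc (d n)) :: ennreal) \<longlonglongrightarrow> X i"
    using diagonal_limit[of "\<lambda>n i. of_nat (w n i) / of_nat (Suc n)"] by blast
  define N where "N n = Suc (d n)" for n
  have N: "strict_mono N" "\<And>n. N n > 0" using d by (auto simp: N_def strict_mono_def)
  note X = X[folded N_def]
  have ev: "(\<lambda>n. of_nat (evtc (N n) (w (d n)) (enc_term h)) / of_nat (N n) :: ennreal) \<longlonglongrightarrow> evE X h" for h
  proof (induction h)
    case (Atom v)
    show ?case
    proof (cases v)
      case (Const k)
      have "of_nat (N n * k) / of_nat (N n) = (of_nat k :: ennreal)" for n
        using N(2)[of n] mult_divide_eq_ennreal[of "of_nat (N n)" "of_nat k"] by (simp add: mult.commute)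
      then show ?thesis using Const by (simp del: enc_term.simps of_nat_mult)
    qed (use X in \<open>simp_all del: enc_term.simps enc_atom.simps\<close>)
  next
    case (Plus h h')
    from tendsto_add[OF this] show ?case by (simp add: add_divide_distrib_ennreal del: enc_term.simps)
  qed
  have "real_ac X c" if "c \<in> AC" for c
  proof (cases c)
    case (ArithGe h h')
    have "evE X h' \<le> evE X h"
    proof (rule le_of_relaxed_limit[OF ev ev N])
      show "\<forall>\<^sub>F n in sequentially. min ((N n)\<^sup>2) (evtc (N n) (w (d n)) (enc_term h'))
          \<le> evtc (N n) (w (d n)) (enc_term h) + tol"
        using ac[OF that] unfolding ArithGe acokc_enc N_def by simp
    qed
    then show ?thesis by (simp add: ArithGe)
  qed
  moreover have "real_tc X u c" if "u \<in> lists L" "c \<in> TC" for u c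
  proof (cases c)
    case (TreeGe t ts)
    let ?node = "\<lambda>s. rootc (enc_tree (fold Child u s))"
    have sum: "(\<lambda>n. of_nat (\<Sum>s\<leftarrow>ts. w (d n) (?node s)) / of_nat (N n) :: ennreal) \<longlonglongrightarrow> (\<Sum>s\<leftarrow>ts. X (?node s))"
    proof (induction ts)
      case (Cons s ts)
      from tendsto_add[OF X[of "?node s"] this] show ?case by (simp add: add_divide_distrib_ennreal)
    qed simp
    have "(\<Sum>s\<leftarrow>ts. X (?node s)) \<le> X (?node t)"
    \<comment> \<open>Eventually the word and the node on the greater side both lie in the checked
      range.\<close>
    proof (rule le_of_relaxed_limit[OF sum X N])
      have "\<forall>\<^sub>F n in sequentially. Suc (max (list_encode u) (?node t)) \<le> N n"
        using filterlim_subseq[OF N(1)] unfolding filterlim_at_top by blast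
      then show "\<forall>\<^sub>F n in sequentially. min ((N n)\<^sup>2) (\<Sum>s\<leftarrow>ts. w (d n) (?node s)) \<le> w (d n) (?node t) + tol"
      proof eventually_elim
        case (elim n)
        have "tcokc (w (d n)) ((N n)\<^sup>2) tol (list_encode u) (enc_tc c)"
          unfolding N_def by (rule tc) (use that elim in \<open>simp_all add: N_def TreeGe fold_childc flip: pair_def\<close>)
        then show ?case unfolding TreeGe tcokc_enc .
      qed
    qed
    then show ?thesis by (simp add: TreeGe)
  qed
  ultimately show ?thesis unfolding rsol_def by blast
qed

section \<open>Certificates of satisfiability\<close>

text \<open>Once \<Omega> exceeds the size bound on finite results, overflow and infinity coincide,
  and integer evaluation is exact up to the factor \<open>q\<close>.\<close>

lemma evtc_inft_exact:
  assumes "\<And>i. Z i \<le> K" "q \<ge> 1" and X: "\<And>i. X i = (if Z i = K then top else of_nat (Z i) / of_nat q)"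
  shows "(\<Omega> \<le> evtc q (inft K \<Omega> Z) (enc_term h) \<and> evE X h = top) \<or>
    (of_nat (evtc q (inft K \<Omega> Z) (enc_term h)) = of_nat q * evE X h \<and>
     evtc q (inft K \<Omega> Z) (enc_term h) \<le> (q + K) * enc_term h)"
proof (induction h)
  case (Atom v)
  have q: "of_nat q \<noteq> (0 :: ennreal)" using assms(2) by simp
  have i: "(\<Omega> \<le> inft K \<Omega> Z i \<and> X i = top) \<or> (of_nat (inft K \<Omega> Z i) = of_nat q * X i \<and> inft K \<Omega> Z i \<le> K)" for i
  proof -
    have "of_nat q * (of_nat (Z i) / of_nat q) = (of_nat (Z i) :: ennreal)"
      using q mult_divide_eq_ennreal[of "of_nat q" "of_nat (Z i)"]
      by (simp add: ennreal_times_divide mult.commute)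
    then show ?thesis using assms(1)[of i] by (simp add: inft_def X)
  qed
  have K: "n \<le> (q + K) * enc_term (Atom v)" if "n \<le> K" "enc_atom v > 0" for n
  proof -
    have "n \<le> (q + K) * 1" using that(1) by simp
    also have "\<dots> \<le> (q + K) * enc_term (Atom v)"
      using that(2) enc_atom_le_enc_term[of v] by (intro mult_le_mono2) linarith
    finally show ?thesis .
  qed
  show ?case
  proof (cases v)
    case (Const n)
    have "q * n \<le> (q + K) * enc_term (Atom (Const n))"
      by (intro mult_le_mono) (auto simp: sum_encode_def)
    then show ?thesis using Const by (simp del: enc_term.simps)
  next
    case (AVar a)
    then have "enc_atom v > 0" by (simp add: sum_encode_def)
    from K[OF _ this] show ?thesis using i[of "enc_atom v"] AVar
      by (auto simp del: enc_term.simps enc_atom.simps)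
  next
    case (Root t)
    then have "enc_atom v > 0" by (simp add: sum_encode_def)
    from K[OF _ this] show ?thesis using i[of "enc_atom v"] Root
      by (auto simp del: enc_term.simps enc_atom.simps)
  qed
next
  case (Plus h h')
  have "(q + K) * enc_term h + (q + K) * enc_term h' \<le> (q + K) * enc_term (Plus h h')"
    unfolding distrib_left[symmetric] by (intro mult_le_mono2 enc_term_Plus_ge)
  with Plus show ?case
    by (auto simp: distrib_left trans_le_add1 trans_le_add2 simp del: enc_term.simps)
qed

section \<open>Unfolding a closed set of windows into a rational solution\<close>

primrec tree_word :: "'l atomic_tree \<Rightarrow> 'l list" where
  "tree_word (TVar x) = []"
| "tree_word (Child l t) = l # tree_word t"

primrec tree_var :: "'l atomic_tree \<Rightarrow> nat" where
  "tree_var (TVar x) = x"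
| "tree_var (Child l t) = tree_var t"

lemma tree_word_foldr: "tree_word (foldr Child u t) = u @ tree_word t"
  and tree_var_foldr: "tree_var (foldr Child u t) = tree_var t"
  by (induction u) simp_all

text \<open>The windows of \<open>Q\<close> are unfolded from \<open>W\<^sub>0\<close> along all words: the window \<open>run u\<close>
  describes the trees \<open>foldr Child u t\<close> with \<open>enc_tree t \<le> e\<close>.\<close>

lemma satisfiable_of_windows:
  fixes Q :: "(nat \<Rightarrow> nat) set"
  assumes q: "q \<ge> 1" and \<Omega>: "\<Omega> = (q + K) * (e + 1)"
    and le: "\<And>W i. W \<in> Q \<Longrightarrow> W i \<le> K"
    and W0: "W0 \<in> Q" "\<And>c. c \<in> AC \<Longrightarrow> acokc q (inft K \<Omega> W0) \<Omega> 0 (enc_ac c)"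
    and tc: "\<And>W c. W \<in> Q \<Longrightarrow> c \<in> TC \<Longrightarrow> tcokc (inft K \<Omega> W) \<Omega> 0 0 (enc_tc c)"
    and succ: "\<And>W a. W \<in> Q \<Longrightarrow> a \<in> L \<Longrightarrow>
      \<exists>W'\<in>Q. \<forall>c. childc a c \<le> e \<longrightarrow> W' (rootc c) = W (rootc (childc a c))"
    and AC: "\<And>c. c \<in> AC \<Longrightarrow> labels_ac c \<subseteq> L \<and> enc_ac c \<le> e"
    and TC: "\<And>c. c \<in> TC \<Longrightarrow> labels_tc c \<subseteq> L \<and> enc_tc c \<le> e"
  shows "satisfiable L AC TC"
proof -
  define step where "step a W = (SOME W'. W' \<in> Q \<and>
    (\<forall>c. childc a c \<le> e \<longrightarrow> W' (rootc c) = W (rootc (childc a c))))" for a W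
  have step: "step a W \<in> Q"
    "\<And>c. childc a c \<le> e \<Longrightarrow> step a W (rootc c) = W (rootc (childc a c))"
    if "W \<in> Q" "a \<in> L" for a W
    using someI_ex[OF succ[OF that, unfolded Bex_def]] unfolding step_def by blast+
  define run where "run u = fold step u W0" for u
  have run: "run u \<in> Q" if "u \<in> lists L" for u
    using that by (induction u rule: rev_induct) (auto simp: run_def W0 step)
  have run_snoc: "run (u @ [a]) = step a (run u)" for u a by (simp add: run_def)
  \<comment> \<open>A node is a word applied to a variable, and its value is read at that variable
    in the window of the word. Words with labels outside \<open>L\<close>, which no constraint
    inspects, get 0.\<close>
  define Z where "Z i = (case inv enc_atom i of
      Root t \<Rightarrow> if tree_word t \<in> lists L then run (tree_word t) (rootc (enc_tree (TVar (tree_var t)))) else 0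
    | _ \<Rightarrow> W0 i)" for i
  have Z: "Z (enc_atom v) = (case v of
      Root t \<Rightarrow> if tree_word t \<in> lists L then run (tree_word t) (rootc (enc_tree (TVar (tree_var t)))) else 0
    | _ \<Rightarrow> W0 (enc_atom v))" for v
    unfolding Z_def by (simp add: inv_f_f injI enc_atom_inj)
  have ZK: "Z i \<le> K" for i
    using le W0(1) run by (auto simp: Z_def split: arith_atom.splits)
  \<comment> \<open>The successor condition moves the letters of \<open>t\<close> one by one into
    the word until only a variable is left, so overlapping windows agree.\<close>
  have Z_node: "Z (rootc (enc_tree (foldr Child u t))) = run u (rootc (enc_tree t))"
    if "enc_tree t \<le> e" "labels_tree t \<subseteq> L" "u \<in> lists L" for t u
    using that
  proof (induction t arbitrary: u)
    case (TVar x)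
    then show ?case using Z[of "Root (foldr Child u (TVar x))"]
      by (simp add: enc_atom_Root tree_word_foldr tree_var_foldr del: enc_atom.simps enc_tree.simps)
  next
    case (Child a t)
    have c: "childc a (enc_tree t) \<le> e" using Child.prems by (simp add: enc_tree_Child del: enc_tree.simps)
    moreover have "enc_tree t < childc a (enc_tree t)"
      using le_prod_encode_2[of "enc_tree t" a] by (simp add: childc_def pair_def)
    ultimately have "Z (rootc (enc_tree (foldr Child (u @ [a]) t))) = run (u @ [a]) (rootc (enc_tree t))"
      using Child.prems by (intro Child.IH) auto
    then show ?case using step(2)[OF run[of u] _ c] Child.prems
      by (simp add: run_snoc enc_tree_Child del: enc_tree.simps)
  qed
  define X where "X i = (if Z i = K then top else of_nat (Z i) / of_nat q :: ennreal)" for i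
  have qK: "(q + K) * m < \<Omega>" if "m \<le> e" for m
  proof -
    have "(q + K) * m \<le> (q + K) * e" using that by simp
    also have "\<dots> < (q + K) * e + (q + K)" using q by simp
    finally show ?thesis by (simp add: \<Omega> distrib_left)
  qed
  have cong: "evtc q (inft K \<Omega> W0) (enc_term h) = evtc q (inft K \<Omega> Z) (enc_term h)"
    if "enc_term h \<le> e" "labels_term h \<subseteq> L" for h
    using that
  proof (induction h)
    case (Atom v)
    show ?case
    proof (cases v)
      case (Root t)
      have "enc_tree t \<le> e" using Atom.prems(1) Root by (simp add: sum_encode_def)
      then have "Z (enc_atom v) = W0 (enc_atom v)"
        using Z_node[of t "[]"] Atom.prems Root enc_atom_Root[of t] by (simp add: run_def del: enc_atom.simps)
      then show ?thesis using Root by (simp add: inft_def del: enc_term.simps enc_atom.simps)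
    qed (simp_all add: Z inft_def del: enc_term.simps enc_atom.simps)
  next
    case (Plus h h')
    then show ?case using enc_term_Plus_ge[of h h'] by (simp del: enc_term.simps)
  qed
  have "real_ac X c" if "c \<in> AC" for c
  proof (cases c)
    case (ArithGe h h')
    have le: "enc_term h \<le> e" "enc_term h' \<le> e"
      using enc_term_le_enc_ac(1)[of h h'] enc_term_le_enc_ac(2)[of h' h] AC[OF that] ArithGe by simp_all
    have "min \<Omega> (evtc q (inft K \<Omega> Z) (enc_term h')) \<le> evtc q (inft K \<Omega> Z) (enc_term h)"
      using W0(2)[OF that] AC[OF that] le unfolding ArithGe acokc_enc by (simp add: cong)
    moreover have "evE X h' \<le> evE X h"
      if "m' \<le> m" "of_nat m' = of_nat q * evE X h'" "of_nat m = of_nat q * evE X h" for m m' :: nat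
    proof -
      have "of_nat q * evE X h' \<le> of_nat q * evE X h"
        using of_nat_mono[OF that(1), where 'a = ennreal] that by simp
      then show ?thesis using q by (subst (asm) ennreal_mult_le_mult_iff) auto
    qed
    ultimately have "evE X h' \<le> evE X h"
      using evtc_inft_exact[where h = h and \<Omega> = \<Omega> and Z = Z and X = X, OF ZK q X_def]
        evtc_inft_exact[where h = h' and \<Omega> = \<Omega> and Z = Z and X = X, OF ZK q X_def]
        qK[OF le(1)] by (auto simp: min_def split: if_splits)
    then show ?thesis by (simp add: ArithGe)
  qed
  moreover have "real_tc X u c" if "u \<in> lists L" "c \<in> TC" for u c
  proof (cases c)
    case (TreeGe t ts)
    let ?node = "\<lambda>s. rootc (enc_tree (fold Child u s))"
    have u: "rev u \<in> lists L" using that(1) by (simp add: in_lists_conv_set)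
    have node: "Z (?node s) = run (rev u) (rootc (enc_tree s))" if "s \<in> set (t # ts)" for s
    proof -
      have "enc_tree s \<le> e"
        using that enc_tree_le_enc_tc(1)[of t ts] enc_tree_le_enc_tc(2)[of s ts t] TC[OF \<open>c \<in> TC\<close>] TreeGe
        by (auto simp del: enc_tc.simps)
      moreover have "labels_tree s \<subseteq> L" using that TC[OF \<open>c \<in> TC\<close>] TreeGe by auto
      ultimately show ?thesis using Z_node[OF _ _ u] by (simp add: foldr_conv_fold)
    qed
    have eq: "inft K \<Omega> (run (rev u)) (rootc (enc_tree s)) = inft K \<Omega> Z (?node s)"
      if "s \<in> set (t # ts)" for s
      by (simp add: inft_def node[OF that])
    have "tcokc (inft K \<Omega> (run (rev u))) \<Omega> 0 (list_encode []) (enc_tc c)"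
      using tc[OF run[OF u] that(2)] by simp
    then have *: "min \<Omega> (\<Sum>s\<leftarrow>ts. inft K \<Omega> Z (?node s)) \<le> inft K \<Omega> Z (?node t)"
      unfolding TreeGe tcokc_enc by (simp add: eq cong: map_cong)
    have "(\<Sum>s\<leftarrow>ts. X (?node s)) \<le> X (?node t)"
    proof (cases "Z (?node t) = K")
      case False
      then have less: "inft K \<Omega> Z (?node t) < \<Omega>"
        using qK[of 0] qK[of e] ZK[of "?node t"] q unfolding \<Omega> by (simp add: inft_def)
      have le: "(\<Sum>s\<leftarrow>ts. inft K \<Omega> Z (?node s)) \<le> Z (?node t)"
        using * less False by (simp add: inft_def)
      \<comment> \<open>A single infinite summand would already contribute \<Omega>, more than the
        finite greater side.\<close>
      have fin: "Z (?node s) \<noteq> K" if "s \<in> set ts" for s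
        using member_le_sum_list[of "inft K \<Omega> Z (?node s)" "map (\<lambda>s. inft K \<Omega> Z (?node s)) ts"]
          that le less False by (auto simp: inft_def)
      have "(\<Sum>s\<leftarrow>ts. X (?node s)) = (\<Sum>s\<leftarrow>ts. of_nat (Z (?node s)) / of_nat q)"
        by (intro arg_cong[where f = sum_list] map_cong) (auto simp: X_def fin)
      also have "\<dots> = of_nat (\<Sum>s\<leftarrow>ts. Z (?node s)) / of_nat q"
        by (induction ts) (auto simp: add_divide_distrib_ennreal)
      also have "(\<Sum>s\<leftarrow>ts. Z (?node s)) = (\<Sum>s\<leftarrow>ts. inft K \<Omega> Z (?node s))"
        by (intro arg_cong[where f = sum_list] map_cong) (auto simp: inft_def fin)
      also have "of_nat \<dots> / of_nat q \<le> (of_nat (Z (?node t)) / of_nat q :: ennreal)"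
        by (intro divide_right_mono_ennreal of_nat_mono le)
      finally show ?thesis using False by (simp add: X_def)
    qed (simp add: X_def)
    then show ?thesis by (simp add: TreeGe)
  qed
  ultimately have "rsol L AC TC X" unfolding rsol_def by blast
  moreover have "X i \<in> DD" for i
  proof (cases "Z i = K")
    case False
    then have "X i = ennreal (real_of_rat (of_nat (Z i) / of_nat q))"
      using q by (simp add: X_def ennreal_of_nat_eq_real_of_nat divide_ennreal of_rat_divide)
    then show ?thesis unfolding DD_def by (auto intro!: exI[of _ "of_nat (Z i) / of_nat q"])
  qed (simp add: X_def DD_def)
  ultimately show ?thesis by (rule rsol_imp_satisfiable)
qed

section \<open>The decision procedure\<close>

text \<open>\<open>unsat_cert e n\<close>: no table on the grid with mesh \<open>1/n\<close> and values at most \<open>n\<close>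
  satisfies the constraints among the first atoms up to an error \<open>(e + 1)/n\<close>.\<close>

definition unsat_cert :: "nat \<Rightarrow> nat \<Rightarrow> bool" where
  "unsat_cert e n \<longleftrightarrow> 1 \<le> n \<and> \<not> (\<exists>\<tau><(n\<^sup>2 + 1) ^ (n + e + 1).
     (\<forall>c\<in>set (list_decode (pfst (psnd e))). acokc n (dig (n\<^sup>2 + 1) \<tau>) (n\<^sup>2) (e + 1) c) \<and>
     (\<forall>u<n. (\<forall>a\<in>set (list_decode u). a \<in> set (list_decode (pfst e))) \<longrightarrow>
       (\<forall>c\<in>set (list_decode (psnd (psnd e))). rootc (actc u (pfst c)) < n + e + 1 \<longrightarrow>
          tcokc (dig (n\<^sup>2 + 1) \<tau>) (n\<^sup>2) (e + 1) u c)))"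

text \<open>\<open>sat_cert e q K Q\<close>: the number \<open>Q\<close> codes a set of tables as in
  \<open>satisfiable_of_windows\<close>.\<close>

definition sat_cert :: "nat \<Rightarrow> nat \<Rightarrow> nat \<Rightarrow> nat \<Rightarrow> bool" where
  "sat_cert e q K Q \<longleftrightarrow> 1 \<le> q \<and>
     (\<exists>W<(Suc K) ^ (4 * e + 4). W \<in> set_decode Q \<and>
        (\<forall>c\<in>set (list_decode (pfst (psnd e))).
           acokc q (inft K ((q + K) * (e + 1)) (dig (Suc K) W)) ((q + K) * (e + 1)) 0 c)) \<and>
     (\<forall>W<(Suc K) ^ (4 * e + 4). W \<in> set_decode Q \<longrightarrow>
        (\<forall>c\<in>set (list_decode (psnd (psnd e))).
           tcokc (inft K ((q + K) * (e + 1)) (dig (Suc K) W)) ((q + K) * (e + 1)) 0 0 c) \<and>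
        (\<forall>a\<in>set (list_decode (pfst e)). \<exists>W'<(Suc K) ^ (4 * e + 4). W' \<in> set_decode Q \<and>
           (\<forall>c<Suc e. childc a c \<le> e \<longrightarrow> dig (Suc K) W' (rootc c) = dig (Suc K) W (rootc (childc a c)))))"

subsection \<open>Correctness\<close>

lemma acokc_cong:
  assumes "\<And>i. i \<le> c \<Longrightarrow> w i = w' i"
  shows "acokc q w \<Omega> tol c = acokc q w' \<Omega> tol c"
proof -
  have "evtc q w g = evtc q w' g" if "g \<le> c" for g
    by (rule evtc_cong) (use assms that in auto)
  then show ?thesis using pfst_le[of c] psnd_le[of c] by (simp add: acokc_def)
qed

context
  fixes L :: "nat list" and AC :: "nat arith_constraint list" and TC :: "nat tree_constraint list" and e :: nat
  assumes inst: "utc_instance (set L) (set AC) (set TC)" and e: "e = enc_instance L AC TC"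
begin

lemma parts_e:
  "list_decode (pfst e) = L"
  "list_decode (pfst (psnd e)) = map enc_ac AC"
  "list_decode (psnd (psnd e)) = map enc_tc TC"
  unfolding e by (simp_all add: pfst_psnd_enc_instance)

lemma not_unsat_cert_of_rsol:
  assumes "rsol (set L) (set AC) (set TC) X"
  shows "\<not> unsat_cert e n"
proof
  assume *: "unsat_cert e n"
  then have n: "n \<ge> 1" by (simp add: unsat_cert_def)
  obtain \<tau> where \<tau>: "\<tau> < (n\<^sup>2 + 1) ^ (n + e + 1)"
    and ac: "\<And>c. c \<in> set AC \<Longrightarrow> acokc n (dig (n\<^sup>2 + 1) \<tau>) (n\<^sup>2) (e + 1) (enc_ac c)"
    and tc: "\<And>u c. u \<in> lists (set L) \<Longrightarrow> c \<in> set TC \<Longrightarrow>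
       rootc (actc (list_encode u) (pfst (enc_tc c))) < n + e + 1 \<Longrightarrow>
        tcokc (dig (n\<^sup>2 + 1) \<tau>) (n\<^sup>2) (e + 1) (list_encode u) (enc_tc c)"
    using relaxed_of_rsol[OF assms n, of e] enc_instance_ge(1)[of _ AC L TC] unfolding e by blast
  have "tcokc (dig (n\<^sup>2 + 1) \<tau>) (n\<^sup>2) (e + 1) u (enc_tc c)"
    if "\<forall>a\<in>set (list_decode u). a \<in> set L" "c \<in> set TC" "rootc (actc u (pfst (enc_tc c))) < n + e + 1" for u c
    using tc[of "list_decode u" c] that by auto
  then show False using * \<tau> ac unfolding unsat_cert_def parts_e by auto
qed

text \<open>Each word yields a window of the rounded solution. There are infinitely many words but
  finitely many windows, since a window has boundedly many digits, each at most
  \<open>K\<close>.\<close>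

lemma ex_sat_cert_of_rsol:
  assumes "rsol (set L) (set AC) (set TC) X"
  shows "\<exists>q K Q. sat_cert e q K Q"
proof -
  obtain q K w where q: "q \<ge> 1" and wK: "\<And>i. w i \<le> K"
    and ac: "\<And>\<Omega> c. \<Omega> \<ge> K \<Longrightarrow> c \<in> set AC \<Longrightarrow> acokc q (inft K \<Omega> w) \<Omega> 0 (enc_ac c)"
    and tc: "\<And>\<Omega> u c. \<Omega> \<ge> K \<Longrightarrow> u \<in> lists (set L) \<Longrightarrow> c \<in> set TC \<Longrightarrow>
       tcokc (inft K \<Omega> w) \<Omega> 0 (list_encode u) (enc_tc c)"
    using exact_of_rsol[OF assms, of e] enc_instance_ge(1)[of _ AC L TC] unfolding e by blast
  define \<Omega> where "\<Omega> = (q + K) * (e + 1)"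
  have \<Omega>: "\<Omega> \<ge> K" by (simp add: \<Omega>_def)
  \<comment> \<open>The largest inspected root is \<open>rootc e = 4 * e + 3\<close>, hence
    \<open>4 * e + 4\<close> digits.\<close>
  let ?b = "Suc K" and ?M = "4 * e + 4"
  \<comment> \<open>Codes of root atoms are those congruent to 3 modulo 4; they are shifted by the
    word, while arithmetic variables are global and keep their values.\<close>
  define W where "W u i = (if i mod 4 = 3 then w (rootc (fold childc u (i div 4))) else w i)" for u i
  have W_rootc: "W u (rootc c) = w (rootc (fold childc u c))" for u c
  proof -
    have "rootc c mod 4 = 3" "rootc c div 4 = c" by (simp_all add: rootc_def)
    then show ?thesis by (simp add: W_def)
  qed
  have W_Nil: "W [] = w"
  proof
    fix i :: nat
    have "rootc (i div 4) = i" if "i mod 4 = 3"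
      using that mult_div_mod_eq[of 4 i] unfolding rootc_def by linarith
    then show "W [] i = w i" by (simp add: W_def)
  qed
  have "\<exists>\<tau><?b ^ ?M. \<forall>i. dig ?b \<tau> i = (if i < ?M then W u i else 0)" for u
    using wK by (intro ex_dig) (auto simp: W_def less_Suc_eq_le)
  then obtain D where D: "\<And>u. D u < ?b ^ ?M" "\<And>u i. dig ?b (D u) i = (if i < ?M then W u i else 0)"
    by metis
  define Q where "Q = set_encode (D ` lists (set L))"
  have "D ` lists (set L) \<subseteq> {..<?b ^ ?M}" using D(1) by auto
  then have Q: "set_decode Q = D ` lists (set L)"
    unfolding Q_def by (intro set_encode_inverse) (rule finite_subset, auto)
  have root_less: "rootc c < ?M \<longleftrightarrow> c \<le> e" for c by (auto simp: rootc_def)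
  have ac': "acokc q (inft K \<Omega> (dig ?b (D []))) \<Omega> 0 (enc_ac c)" if "c \<in> set AC" for c
  proof -
    have "inft K \<Omega> (dig ?b (D [])) i = inft K \<Omega> w i" if "i \<le> enc_ac c" for i
      using that enc_instance_ge(1)[OF \<open>c \<in> set AC\<close>, of L TC] by (simp add: inft_def D(2) W_Nil e)
    from acokc_cong[OF this] show ?thesis using ac[OF \<Omega> that] by simp
  qed
  have tc': "tcokc (inft K \<Omega> (dig ?b (D u))) \<Omega> 0 0 (enc_tc c)"
    if "u \<in> lists (set L)" "c \<in> set TC" for u c
  proof (cases c)
    case (TreeGe t ts)
    have "inft K \<Omega> (dig ?b (D u)) (rootc (enc_tree s)) = inft K \<Omega> w (rootc (enc_tree (fold Child u s)))"
      if "s \<in> set (t # ts)" for s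
    proof -
      have "enc_tree s \<le> e"
        using that enc_tree_le_enc_tc(1)[of t ts] enc_tree_le_enc_tc(2)[of s ts t]
          enc_instance_ge(2)[OF \<open>c \<in> set TC\<close>, of L AC] TreeGe by (auto simp: e simp del: enc_tc.simps)
      then show ?thesis by (simp add: inft_def D(2) root_less W_rootc fold_childc)
    qed
    then have "tcokc (inft K \<Omega> (dig ?b (D u))) \<Omega> 0 (list_encode []) (enc_tc c)"
      using tc[OF \<Omega> that] unfolding TreeGe tcokc_enc by (simp cong: map_cong)
    then show ?thesis by simp
  qed
  have succ: "\<exists>W'<?b ^ ?M. W' \<in> set_decode Q \<and>
      (\<forall>c<Suc e. childc a c \<le> e \<longrightarrow> dig ?b W' (rootc c) = dig ?b (D u) (rootc (childc a c)))"
    if "u \<in> lists (set L)" "a \<in> set L" for u a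
  proof (intro exI[of _ "D (a # u)"] conjI allI impI D(1))
    show "D (a # u) \<in> set_decode Q" using that by (simp add: Q)
    fix c assume "c < Suc e" "childc a c \<le> e"
    then show "dig ?b (D (a # u)) (rootc c) = dig ?b (D u) (rootc (childc a c))"
      by (simp add: D(2) root_less W_rootc)
  qed
  have "sat_cert e q K Q"
    unfolding sat_cert_def parts_e \<Omega>_def[symmetric]
  proof (intro conjI allI impI)
    show "\<exists>W<?b ^ ?M. W \<in> set_decode Q \<and>
        (\<forall>c\<in>set (map enc_ac AC). acokc q (inft K \<Omega> (dig ?b W)) \<Omega> 0 c)"
      using D(1) ac' by (intro exI[of _ "D []"]) (simp add: Q)
    fix W assume "W < ?b ^ ?M" "W \<in> set_decode Q"
    then obtain u where u: "u \<in> lists (set L)" "W = D u" unfolding Q by blast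
    show "\<forall>c\<in>set (map enc_tc TC). tcokc (inft K \<Omega> (dig ?b W)) \<Omega> 0 0 c"
      using tc'[OF u(1)] u(2) by simp
    show "\<forall>a\<in>set L. \<exists>W'<?b ^ ?M. W' \<in> set_decode Q \<and>
        (\<forall>c<Suc e. childc a c \<le> e \<longrightarrow> dig ?b W' (rootc c) = dig ?b W (rootc (childc a c)))"
      using succ[OF u(1)] u(2) by blast
  qed (rule q)
  then show ?thesis by blast
qed

lemma satisfiable_of_sat_cert:
  assumes "sat_cert e q K Q"
  shows "satisfiable (set L) (set AC) (set TC)"
proof -
  let ?b = "Suc K" and ?M = "4 * e + 4" and ?\<Omega> = "(q + K) * (e + 1)"
  define QQ where "QQ = dig ?b ` {W. W < ?b ^ ?M \<and> W \<in> set_decode Q}"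
  note c = assms[unfolded sat_cert_def parts_e]
  obtain W0 where W0: "W0 < ?b ^ ?M" "W0 \<in> set_decode Q"
    "\<And>c. c \<in> set AC \<Longrightarrow> acokc q (inft K ?\<Omega> (dig ?b W0)) ?\<Omega> 0 (enc_ac c)"
    using c by auto
  show ?thesis
  proof (rule satisfiable_of_windows[where Q = QQ and ?W0.0 = "dig ?b W0" and e = e and \<Omega> = ?\<Omega>])
    show "\<exists>W'\<in>QQ. \<forall>c. childc a c \<le> e \<longrightarrow> W' (rootc c) = W (rootc (childc a c))"
      if "W \<in> QQ" "a \<in> set L" for W a
    proof -
      obtain V where V: "W = dig ?b V" "V < ?b ^ ?M" "V \<in> set_decode Q"
        using \<open>W \<in> QQ\<close> by (auto simp: QQ_def)
      then obtain V' where V': "V' < ?b ^ ?M" "V' \<in> set_decode Q"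
        "\<And>c. c < Suc e \<Longrightarrow> childc a c \<le> e \<Longrightarrow> dig ?b V' (rootc c) = dig ?b V (rootc (childc a c))"
        using c \<open>a \<in> set L\<close> by blast
      \<comment> \<open>A child has a code at least that of its subterm, so the bounded quantifier
        in the certificate covers every relevant \<open>c\<close>.\<close>
      have "c < Suc e" if "childc a c \<le> e" for c
        using that le_prod_encode_2[of c a] by (simp add: childc_def pair_def)
      then show ?thesis using V' V(1) by (auto simp: QQ_def)
    qed
    show "tcokc (inft K ?\<Omega> W) ?\<Omega> 0 0 (enc_tc d)" if "W \<in> QQ" "d \<in> set TC" for W d
      using that c by (auto simp: QQ_def)
    show "W i \<le> K" if "W \<in> QQ" for W i
      using that dig_less[of ?b] by (auto simp: QQ_def less_Suc_eq_le)
    show "labels_ac d \<subseteq> set L \<and> enc_ac d \<le> e" if "d \<in> set AC" for d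
      using inst that enc_instance_ge(1)[OF that] by (auto simp: utc_instance_def e)
    show "labels_tc d \<subseteq> set L \<and> enc_tc d \<le> e" if "d \<in> set TC" for d
      using inst that enc_instance_ge(2)[OF that] by (auto simp: utc_instance_def e)
  qed (use c W0 in \<open>auto simp: QQ_def\<close>)
qed

text \<open>Without refutations, relaxed tables exist at every scale, and compactness gives an
  extended real solution. Rounding it yields a satisfiability certificate and hence a solution in
  \<open>DD\<close>, a contradiction.\<close>

lemma ex_unsat_cert:
  assumes "\<not> satisfiable (set L) (set AC) (set TC)"
  shows "\<exists>n. unsat_cert e n"
proof (rule ccontr)
  assume none: "\<not> ?thesis"
  have "\<exists>X. rsol (set L) (set AC) (set TC) X"
  proof (rule rsol_of_relaxed)
    fix n :: nat assume "n \<ge> 1"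
    moreover have "\<not> unsat_cert e n" using none by blast
    ultimately obtain \<tau> where \<tau>:
      "\<forall>c\<in>set (map enc_ac AC). acokc n (dig (n\<^sup>2 + 1) \<tau>) (n\<^sup>2) (e + 1) c"
      "\<forall>u<n. (\<forall>a\<in>set (list_decode u). a \<in> set L) \<longrightarrow>
        (\<forall>c\<in>set (map enc_tc TC). rootc (actc u (pfst c)) < n + e + 1 \<longrightarrow>
          tcokc (dig (n\<^sup>2 + 1) \<tau>) (n\<^sup>2) (e + 1) u c)"
      unfolding unsat_cert_def parts_e by blast
    have ac: "acokc n (dig (n\<^sup>2 + 1) \<tau>) (n\<^sup>2) (e + 1) (enc_ac c)" if "c \<in> set AC" for c
      using \<tau>(1) that by simp
    have tc: "tcokc (dig (n\<^sup>2 + 1) \<tau>) (n\<^sup>2) (e + 1) u (enc_tc c)"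
      if "u < n" "\<forall>a\<in>set (list_decode u). a \<in> set L" "c \<in> set TC"
        "rootc (actc u (pfst (enc_tc c))) < n + e + 1" for u c
      using \<tau>(2) that by simp
    have "tcokc (dig (n\<^sup>2 + 1) \<tau>) (n\<^sup>2) (e + 1) (list_encode u) (enc_tc c)"
      if "u \<in> lists (set L)" "list_encode u < n" "c \<in> set TC" "rootc (actc (list_encode u) (pfst (enc_tc c))) < n" for u c
      using that by (intro tc) auto
    then show "\<exists>w. (\<forall>c\<in>set AC. acokc n w (n\<^sup>2) (e + 1) (enc_ac c)) \<and>
      (\<forall>u\<in>lists (set L). list_encode u < n \<longrightarrow> (\<forall>c\<in>set TC. rootc (actc (list_encode u) (pfst (enc_tc c))) < n \<longrightarrow>
        tcokc w (n\<^sup>2) (e + 1) (list_encode u) (enc_tc c)))"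
      using ac by blast
  qed
  then show False using ex_sat_cert_of_rsol satisfiable_of_sat_cert assms by blast
qed

end

subsection \<open>Computability\<close>

lemma computable_childc [comp_intros]:
  "computable f \<Longrightarrow> computable g \<Longrightarrow> computable (\<lambda>x. childc (f x) (g x))"
  unfolding childc_def by (intro comp_intros)

lemma computable_rootc [comp_intros]: "computable f \<Longrightarrow> computable (\<lambda>x. rootc (f x))"
  unfolding rootc_def by (intro comp_intros)

lemma computable_actc [comp_intros]:
  "computable f \<Longrightarrow> computable g \<Longrightarrow> computable (\<lambda>x. actc (f x) (g x))"
  unfolding actc_def by (intro comp_intros)

lemma computable_dig [comp_intros]:
  "computable b \<Longrightarrow> computable \<tau> \<Longrightarrow> computable i \<Longrightarrow> computable (\<lambda>x. dig (b x) (\<tau> x) (i x))"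
  unfolding dig_def by (intro comp_intros)

lemma computable_inft [comp_intros]:
  "computable K \<Longrightarrow> computable \<Omega> \<Longrightarrow> computable (\<lambda>x. w x (i x)) \<Longrightarrow>
    computable (\<lambda>x. inft (K x) (\<Omega> x) (w x) (i x))"
  unfolding inft_def by (intro comp_intros)

text \<open>Evaluation of a sum calls itself on two smaller codes, so both values are looked up in
  the history. As that is stored in reverse, the value at \<open>j\<close> has position
  \<open>k - Suc j\<close>.\<close>

lemma computable_evtc [comp_intros]:
  assumes "computable q" "computable h" "computable (\<lambda>z. w (pfst z) (psnd z))"
  shows "computable (\<lambda>x. evtc (q x) (w x) (h x))"
proof (rule computable_course_of_values[OF assms(2)])
  let ?look = "\<lambda>r n. pfst (rec_nat r (\<lambda>_ r. psnd (r - 1)) n - 1)"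
  let ?G = "\<lambda>x k r. if even k then (if even (k div 2) then q x * (k div 2 div 2) else w x (k div 2))
    else ?look r (k - Suc (pfst (k div 2))) + ?look r (k - Suc (psnd (k div 2)))"
  have q: "computable (\<lambda>z. q (f z))" if "computable f" for f
    by (rule computable_comp[OF assms(1) that])
  have w: "computable (\<lambda>z. w (f z) (g z))" if "computable f" "computable g" for f g
    using computable_comp[OF assms(3) computable_pair[OF that]] by simp
  show "computable (\<lambda>z. ?G (pfst z) (pfst (psnd z)) (psnd (psnd z)))"
    by (intro comp_intros q w)
  fix x k
  let ?f = "evtc (q x) (w x)"
  have look: "?look (list_encode (rev (map ?f [0..<k]))) (k - Suc j) = ?f j" if "j < k" for j
    using that by (subst nth_list_decode) (simp_all add: rev_nth)
  have "pfst (k div 2) < k" "psnd (k div 2) < k" if "odd k"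
    using that pfst_le[of "k div 2"] psnd_le[of "k div 2"] by (cases k; auto)+
  then show "?G x k (list_encode (rev (map ?f [0..<k]))) = ?f k"
    using look[of "pfst (k div 2)"] look[of "psnd (k div 2)"]
    by (simp add: evtc.simps[of "q x" "w x" k])
qed

lemma decidable_acokc [comp_intros]:
  assumes "computable q" "computable \<Omega>" "computable tol" "computable c"
    "computable (\<lambda>z. w (pfst z) (psnd z))"
  shows "decidable (\<lambda>x. acokc (q x) (w x) (\<Omega> x) (tol x) (c x))"
  unfolding acokc_def by (intro comp_intros assms)

lemma decidable_tcokc [comp_intros]:
  assumes "computable \<Omega>" "computable tol" "computable u" "computable c"
    "computable (\<lambda>z. w (pfst z) (psnd z))"
  shows "decidable (\<lambda>x. tcokc (w x) (\<Omega> x) (tol x) (u x) (c x))"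
proof -
  have w: "computable (\<lambda>z. w (f z) (g z))" if "computable f" "computable g" for f g
    using computable_comp[OF assms(5) computable_pair[OF that]] by simp
  show ?thesis
    unfolding tcokc_def by (intro comp_intros w assms computable_comp[OF assms(3)])
qed

lemma decidable_unsat_cert [comp_intros]:
  assumes "computable e" "computable n"
  shows "decidable (\<lambda>x. unsat_cert (e x) (n x))"
  unfolding unsat_cert_def
  by (intro comp_intros assms computable_comp[OF assms(1)] computable_comp[OF assms(2)])

lemma decidable_sat_cert [comp_intros]:
  assumes "computable e" "computable q" "computable K" "computable Q"
  shows "decidable (\<lambda>x. sat_cert (e x) (q x) (K x) (Q x))"
  unfolding sat_cert_def
  by (intro comp_intros assms computable_comp[OF assms(1)] computable_comp[OF assms(2)]
      computable_comp[OF assms(3)] computable_comp[OF assms(4)])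

theorem mainTheorem1:
  "\<exists>p. \<forall>(L :: nat list) (AC :: nat arith_constraint list) (TC :: nat tree_constraint list).
     utc_instance (set L) (set AC) (set TC) \<longrightarrow>
     computes p [enc_instance L AC TC]
       (if satisfiable (set L) (set AC) (set TC) then 1 else 0)"
proof -
  define S where "S e m = sat_cert e (pfst m) (pfst (psnd m)) (psnd (psnd m))" for e m
  \<comment> \<open>One search variable serves both kinds of certificate: as a code of the triple
    \<open>q\<close>, \<open>K\<close>, \<open>Q\<close>, and directly as the scale of a
    refutation.\<close>
  define P where "P e m \<longleftrightarrow> S e m \<or> unsat_cert e m" for e m
  have "decidable (\<lambda>z. P (pfst z) (psnd z))"
    unfolding P_def S_def by (intro comp_intros)
  moreover have "computable (\<lambda>z. of_bool (S (pfst z) (psnd z)))"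
    unfolding S_def decidable_def[symmetric] by (intro comp_intros)
  ultimately obtain p where
    p: "\<And>e. \<exists>m. P e m \<Longrightarrow> computes p [e] (of_bool (S e (LEAST m. P e m)))"
    using computes_search[of P "\<lambda>e m. of_bool (S e m)"] by auto
  have "computes p [enc_instance L AC TC] (if satisfiable (set L) (set AC) (set TC) then 1 else 0)"
    if inst: "utc_instance (set L) (set AC) (set TC)" for L AC TC
  proof -
    define e where "e = enc_instance L AC TC"
    note cert = not_unsat_cert_of_rsol[OF inst e_def] ex_sat_cert_of_rsol[OF inst e_def]
      satisfiable_of_sat_cert[OF inst e_def] ex_unsat_cert[OF inst e_def]
    show ?thesis
    proof (cases "satisfiable (set L) (set AC) (set TC)")
      case True
      then obtain X where X: "rsol (set L) (set AC) (set TC) X" using satisfiable_imp_rsol by blast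
      have "\<exists>m. S e m"
        using cert(2)[OF X] unfolding S_def by (metis pfst_pair psnd_pair)
      then have ex: "\<exists>m. P e m" by (auto simp: P_def)
      \<comment> \<open>Refutations are sound, so the first certificate found must be one of
        satisfiability.\<close>
      from LeastI_ex[OF this] have "S e (LEAST m. P e m)" using cert(1)[OF X] by (auto simp: P_def)
      then show ?thesis using p[OF ex] True by (simp add: e_def)
    next
      case False
      have ex: "\<exists>m. P e m" using cert(4)[OF False] by (auto simp: P_def)
      have "\<not> S e m" for m using cert(3) False unfolding S_def by blast
      then show ?thesis using p[OF ex] False by (simp add: e_def)
    qed
  qed
  then show ?thesis by blast
qed

end
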